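(* Let $U\subset\mathbb{R}^2$ be open with coordinates $(x,y)$, let $h:U\to\mathbb{R}$ be a smooth positive function, and let $g_\Sigma=h^2(dx^2+dy^2)$ be the corresponding Riemannian metric on $U$, with volume form $\omega_\Sigma=h^2\,dx\wedge dy$. Let $H:U\to\mathbb{R}$ be a smooth positive function satisfying $$\Delta\ln H=(\ln H)_{xx}+(\ln H)_{yy}=\tfrac12h^2-H^2\quad\text{on }U,$$ and put $l_2=-(\ln H)_y$, $n_2=(\ln H)_x$. Let $N=\{(z,t)\in\mathbb{R}^2: 0<z<\pi\}$ and $M=U\times N$. Define one-forms on $M$ by $$\theta_3=\sin z\,dt-\bigl(\cos t\cos z\,H(x,y)+\sin z\,l_2(x,y)\bigr)dx-\bigl(-\sin t\cos z\,H(x,y)+\sin z\,n_2(x,y)\bigr)dy,$$ $$\theta_4=dz-\sin t\,H(x,y)\,dx-\cos t\,H(x,y)\,dy,$$ and define the metric $g$ on $M$ by $$g(X,Y)=(\cos\tfrac12z)^2g_\Sigma(X,Y)+\theta_3(X)\theta_3(Y)+\theta_4(X)\theta_4(Y).$$ Then: 1. $(M,g)$ admits a Kähler structure $\bar J$ with Kähler form $\bar\Omega=(\cos\frac12z)^2\omega_\Sigma+\theta_4\wedge\theta_3$ and a Hermitian structure $J$ with Kähler form $\Omega=(\cos\frac12z)^2\omega_\Sigma+\theta_3\wedge\theta_4$. 2. The Ricci tensor of $(M,g)$ is $J$-invariant, and $J$ is not locally conformally Kähler. 3. The Lee form of $(M,g,J)$ is $\theta=-\alpha\theta_4$, where $\alpha=\tan\frac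 z2$.
   Context: Tensors on $U$ are pulled back to $M=U\times N$ by the projection, and $\Delta f=f_{xx}+f_{yy}$ is the flat Laplacian on $U$. An almost Hermitian structure on $(M,g)$ is an almost complex structure $J$ with $g(JX,JY)=g(X,Y)$. Its Kähler form is $\Omega(X,Y)=g(JX,Y)$. It is Hermitian if $J$ is integrable (vanishing Nijenhuis tensor), and Kähler if in addition $d\Omega=0$. The Lee form $\theta$ of a 4-dimensional Hermitian manifold $(M,g,J)$ is defined by $d\Omega=2\theta\wedge\Omega$. The structure $J$ is locally conformally Kähler if $d\theta=0$, i.e. $g$ is locally conformal to a metric which is Kähler with respect to $J$. The Ricci tensor $\rho$ is $J$-invariant if $\rho(JX,JY)=\rho(X,Y)$ for all vector fields $X,Y$. *)

theory Defs
  imports "HOL-Analysis.Analysis"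
begin

text \<open>
  Everything takes place on open subsets of a Euclidean space, so the tangent space at each point
  is the Euclidean space itself. A tensor field is a function of the base point and of
  tangent vectors. The ambient inner product is used only to compute traces.
\<close>

definition dderiv ::
    "('a::real_normed_vector \<Rightarrow> 'b::real_normed_vector) \<Rightarrow> 'a \<Rightarrow> 'a \<Rightarrow> 'b" where
  "dderiv f p v = frechet_derivative f (at p) v"

primrec Ck_on :: "nat \<Rightarrow> 'a::real_normed_vector set \<Rightarrow> ('a \<Rightarrow> 'b::real_normed_vector) \<Rightarrow> bool" where
  "Ck_on 0 S f \<longleftrightarrow> continuous_on S f"
| "Ck_on (Suc k) S f \<longleftrightarrow>
     (\<forall>p\<in>S. f differentiable (at p)) \<and> (\<forall>v. Ck_on k S (\<lambda>p. dderiv f p v))"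

definition smooth_on :: "'a::real_normed_vector set \<Rightarrow> ('a \<Rightarrow> 'b::real_normed_vector) \<Rightarrow> bool" where
  "smooth_on S f \<longleftrightarrow> (\<forall>k. Ck_on k S f)"

type_synonym 'a vfield = "'a \<Rightarrow> 'a"
type_synonym 'a form1 = "'a \<Rightarrow> 'a \<Rightarrow> real"
type_synonym 'a tensor2 = "'a \<Rightarrow> 'a \<Rightarrow> 'a \<Rightarrow> real"
type_synonym 'a form3 = "'a \<Rightarrow> 'a \<Rightarrow> 'a \<Rightarrow> 'a \<Rightarrow> real"
type_synonym 'a endo = "'a \<Rightarrow> 'a \<Rightarrow> 'a"

definition smooth_form1 :: "'a::euclidean_space set \<Rightarrow> 'a form1 \<Rightarrow> bool" where
  "smooth_form1 M \<theta> \<longleftrightarrow>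
     (\<forall>p\<in>M. linear (\<theta> p)) \<and> (\<forall>v. smooth_on M (\<lambda>p. \<theta> p v))"

text \<open>Wedge products and exterior derivatives are normalised without factors
  \<open>1/k!\<close>, so that \<open>dx \<and> dy\<close> takes the value 1 on the coordinate frame. In the exterior
  derivatives the arguments are extended to constant vector fields, whose brackets vanish.\<close>

definition wedge11 :: "('a \<Rightarrow> real) \<Rightarrow> ('a \<Rightarrow> real) \<Rightarrow> 'a \<Rightarrow> 'a \<Rightarrow> real" where
  "wedge11 \<alpha> \<beta> u v = \<alpha> u * \<beta> v - \<alpha> v * \<beta> u"

definition wedge12 :: "('a \<Rightarrow> real) \<Rightarrow> ('a \<Rightarrow> 'a \<Rightarrow> real) \<Rightarrow> 'a \<Rightarrow> 'a \<Rightarrow> 'a \<Rightarrow> real" where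
  "wedge12 \<alpha> \<omega> u v w = \<alpha> u * \<omega> v w + \<alpha> v * \<omega> w u + \<alpha> w * \<omega> u v"

definition extd1 :: "'a::euclidean_space form1 \<Rightarrow> 'a tensor2" where
  "extd1 \<alpha> p u v = dderiv (\<lambda>q. \<alpha> q v) p u - dderiv (\<lambda>q. \<alpha> q u) p v"

definition extd2 :: "'a::euclidean_space tensor2 \<Rightarrow> 'a form3" where
  "extd2 \<omega> p u v w =
     dderiv (\<lambda>q. \<omega> q v w) p u + dderiv (\<lambda>q. \<omega> q w u) p v + dderiv (\<lambda>q. \<omega> q u v) p w"

definition lie_bracket :: "'a::euclidean_space vfield \<Rightarrow> 'a vfield \<Rightarrow> 'a vfield" where
  "lie_bracket X Y p = dderiv Y p (X p) - dderiv X p (Y p)"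

definition nijenhuis ::
    "'a::euclidean_space endo \<Rightarrow> 'a vfield \<Rightarrow> 'a vfield \<Rightarrow> 'a vfield" where
  "nijenhuis J X Y p =
     lie_bracket (\<lambda>q. J q (X q)) (\<lambda>q. J q (Y q)) p
     - J p (lie_bracket (\<lambda>q. J q (X q)) Y p)
     - J p (lie_bracket X (\<lambda>q. J q (Y q)) p)
     - lie_bracket X Y p"

definition riemannian_metric :: "'a::euclidean_space set \<Rightarrow> 'a tensor2 \<Rightarrow> bool" where
  "riemannian_metric M g \<longleftrightarrow>
     (\<forall>p\<in>M. bilinear (g p) \<and> (\<forall>v w. g p v w = g p w v) \<and> (\<forall>v. v \<noteq> 0 \<longrightarrow> g p v v > 0)) \<and>
     (\<forall>v w. smooth_on M (\<lambda>p. g p v w))"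

definition almost_complex_structure :: "'a::euclidean_space set \<Rightarrow> 'a endo \<Rightarrow> bool" where
  "almost_complex_structure M J \<longleftrightarrow>
     (\<forall>p\<in>M. linear (J p) \<and> (\<forall>v. J p (J p v) = - v)) \<and>
     (\<forall>v. smooth_on M (\<lambda>p. J p v))"

definition integrable_structure :: "'a::euclidean_space set \<Rightarrow> 'a endo \<Rightarrow> bool" where
  "integrable_structure M J \<longleftrightarrow>
     (\<forall>X Y. smooth_on M X \<longrightarrow> smooth_on M Y \<longrightarrow> (\<forall>p\<in>M. nijenhuis J X Y p = 0))"

definition almost_hermitian ::
    "'a::euclidean_space set \<Rightarrow> 'a tensor2 \<Rightarrow> 'a endo \<Rightarrow> bool" where
  "almost_hermitian M g J \<longleftrightarrow>
     riemannian_metric M g \<and> almost_complex_structure M J \<and>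
     (\<forall>p\<in>M. \<forall>v w. g p (J p v) (J p w) = g p v w)"

definition kaehler_form :: "'a tensor2 \<Rightarrow> 'a endo \<Rightarrow> 'a tensor2" where
  "kaehler_form g J p v w = g p (J p v) w"

definition hermitian :: "'a::euclidean_space set \<Rightarrow> 'a tensor2 \<Rightarrow> 'a endo \<Rightarrow> bool" where
  "hermitian M g J \<longleftrightarrow> almost_hermitian M g J \<and> integrable_structure M J"

definition kaehler :: "'a::euclidean_space set \<Rightarrow> 'a tensor2 \<Rightarrow> 'a endo \<Rightarrow> bool" where
  "kaehler M g J \<longleftrightarrow>
     hermitian M g J \<and> (\<forall>p\<in>M. \<forall>u v w. extd2 (kaehler_form g J) p u v w = 0)"

text \<open>In real dimension 4 the Lee form exists and is unique on \<open>M\<close>.\<close>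

definition is_lee_form ::
    "'a::euclidean_space set \<Rightarrow> 'a tensor2 \<Rightarrow> 'a endo \<Rightarrow> 'a form1 \<Rightarrow> bool" where
  "is_lee_form M g J \<theta> \<longleftrightarrow>
     smooth_form1 M \<theta> \<and>
     (\<forall>p\<in>M. \<forall>u v w.
        extd2 (kaehler_form g J) p u v w = 2 * wedge12 (\<theta> p) (kaehler_form g J p) u v w)"

definition locally_conformally_kaehler ::
    "'a::euclidean_space set \<Rightarrow> 'a tensor2 \<Rightarrow> 'a endo \<Rightarrow> bool" where
  "locally_conformally_kaehler M g J \<longleftrightarrow>
     (\<exists>\<theta>. is_lee_form M g J \<theta> \<and> (\<forall>p\<in>M. \<forall>u v. extd1 \<theta> p u v = 0))"

text \<open>The Koszul formula for constant vector fields \<open>u\<close>, \<open>v\<close>, \<open>k\<close>; the vector \<open>w\<close> is unique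
  wherever \<open>g\<close> is nondegenerate.\<close>

definition christoffel :: "'a::euclidean_space tensor2 \<Rightarrow> 'a \<Rightarrow> 'a \<Rightarrow> 'a \<Rightarrow> 'a" where
  "christoffel g p u v =
     (THE w. \<forall>k. 2 * g p w k =
        dderiv (\<lambda>q. g q v k) p u + dderiv (\<lambda>q. g q u k) p v - dderiv (\<lambda>q. g q u v) p k)"

definition levi_civita ::
    "'a::euclidean_space tensor2 \<Rightarrow> 'a vfield \<Rightarrow> 'a vfield \<Rightarrow> 'a vfield" where
  "levi_civita g X Y p = dderiv Y p (X p) + christoffel g p (X p) (Y p)"

definition curvature ::
    "'a::euclidean_space tensor2 \<Rightarrow> 'a vfield \<Rightarrow> 'a vfield \<Rightarrow> 'a vfield \<Rightarrow> 'a vfield" where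
  "curvature g X Y Z p =
     levi_civita g X (levi_civita g Y Z) p - levi_civita g Y (levi_civita g X Z) p
     - levi_civita g (lie_bracket X Y) Z p"

text \<open>The trace of \<open>X \<mapsto> R(X,v)w\<close>. Since \<open>R\<close> is tensorial, tangent
  vectors may be extended to constant fields.\<close>

definition ricci :: "'a::euclidean_space tensor2 \<Rightarrow> 'a tensor2" where
  "ricci g p v w = (\<Sum>b\<in>Basis. curvature g (\<lambda>_. b) (\<lambda>_. v) (\<lambda>_. w) p \<bullet> b)"

definition ricci_J_invariant ::
    "'a::euclidean_space set \<Rightarrow> 'a tensor2 \<Rightarrow> 'a endo \<Rightarrow> bool" where
  "ricci_J_invariant M g J \<longleftrightarrow>
     (\<forall>p\<in>M. \<forall>v w. ricci g p (J p v) (J p w) = ricci g p v w)"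

text \<open>Points of \<open>\<real>\<^sup>2\<close> are pairs \<open>(x, y)\<close>, and points of the 4-manifold are pairs
  \<open>((x, y), (z, t))\<close>, so that the projection to the surface is \<open>fst\<close>. Tangent vectors have the
  same shape, so \<open>dx\<close> is the projection to the first coordinate, and so on.\<close>

type_synonym plane = "real \<times> real"
type_synonym space4 = "plane \<times> plane"

abbreviation dx :: "space4 \<Rightarrow> real" where "dx v \<equiv> fst (fst v)"
abbreviation dy :: "space4 \<Rightarrow> real" where "dy v \<equiv> snd (fst v)"
abbreviation dz :: "space4 \<Rightarrow> real" where "dz v \<equiv> fst (snd v)"
abbreviation dt :: "space4 \<Rightarrow> real" where "dt v \<equiv> snd (snd v)"
abbreviation zcoord :: "space4 \<Rightarrow> real" where "zcoord p \<equiv> fst (snd p)"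
abbreviation tcoord :: "space4 \<Rightarrow> real" where "tcoord p \<equiv> snd (snd p)"

definition partial_x :: "(plane \<Rightarrow> real) \<Rightarrow> plane \<Rightarrow> real" where
  "partial_x f q = dderiv f q (1, 0)"

definition partial_y :: "(plane \<Rightarrow> real) \<Rightarrow> plane \<Rightarrow> real" where
  "partial_y f q = dderiv f q (0, 1)"

definition laplacian :: "(plane \<Rightarrow> real) \<Rightarrow> plane \<Rightarrow> real" where
  "laplacian f q = partial_x (partial_x f) q + partial_y (partial_y f) q"

definition surface_metric :: "(plane \<Rightarrow> real) \<Rightarrow> plane tensor2" where
  "surface_metric h q a b = (h q)\<^sup>2 * (fst a * fst b + snd a * snd b)"

definition surface_volume :: "(plane \<Rightarrow> real) \<Rightarrow> plane tensor2" where
  "surface_volume h q a b = (h q)\<^sup>2 * wedge11 fst snd a b"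

definition l2 :: "(plane \<Rightarrow> real) \<Rightarrow> plane \<Rightarrow> real" where
  "l2 H q = - partial_y (\<lambda>r. ln (H r)) q"

definition n2 :: "(plane \<Rightarrow> real) \<Rightarrow> plane \<Rightarrow> real" where
  "n2 H q = partial_x (\<lambda>r. ln (H r)) q"

definition theta3 :: "(plane \<Rightarrow> real) \<Rightarrow> space4 form1" where
  "theta3 H p v =
     sin (zcoord p) * dt v
     - (cos (tcoord p) * cos (zcoord p) * H (fst p) + sin (zcoord p) * l2 H (fst p)) * dx v
     - (- sin (tcoord p) * cos (zcoord p) * H (fst p) + sin (zcoord p) * n2 H (fst p)) * dy v"

definition theta4 :: "(plane \<Rightarrow> real) \<Rightarrow> space4 form1" where
  "theta4 H p v =
     dz v - sin (tcoord p) * H (fst p) * dx v - cos (tcoord p) * H (fst p) * dy v"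

definition metric4 :: "(plane \<Rightarrow> real) \<Rightarrow> (plane \<Rightarrow> real) \<Rightarrow> space4 tensor2" where
  "metric4 h H p v w =
     (cos (zcoord p / 2))\<^sup>2 * surface_metric h (fst p) (fst v) (fst w)
     + theta3 H p v * theta3 H p w + theta4 H p v * theta4 H p w"

definition Omega_bar :: "(plane \<Rightarrow> real) \<Rightarrow> (plane \<Rightarrow> real) \<Rightarrow> space4 tensor2" where
  "Omega_bar h H p v w =
     (cos (zcoord p / 2))\<^sup>2 * surface_volume h (fst p) (fst v) (fst w)
     + wedge11 (theta4 H p) (theta3 H p) v w"

definition Omega :: "(plane \<Rightarrow> real) \<Rightarrow> (plane \<Rightarrow> real) \<Rightarrow> space4 tensor2" where
  "Omega h H p v w =
     (cos (zcoord p / 2))\<^sup>2 * surface_volume h (fst p) (fst v) (fst w)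
     + wedge11 (theta3 H p) (theta4 H p) v w"

end

theory Submission
  imports Defs
begin

text \<open>
  Why the theorem holds. Write \<open>a = H (cos t dx - sin t dy)\<close>,
  \<open>b = H (sin t dx + cos t dy)\<close> and \<open>\<beta> = dt - l\<^sub>2 dx - n\<^sub>2 dy\<close>. The form \<open>\<beta>\<close> is the
  connection form of the surface metric \<open>H\<^sup>2 (dx\<^sup>2 + dy\<^sup>2)\<close> in the rotated coframe \<open>a, b\<close>, so
  \<open>da = - \<beta> \<and> b\<close>, \<open>db = \<beta> \<and> a\<close> and \<open>d\<beta> = - (\<Delta> ln H) dx \<and> dy\<close>, which by the equation for \<open>H\<close>
  equals \<open>(H\<^sup>2 - h\<^sup>2/2) dx \<and> dy\<close>. In these terms \<open>\<theta>\<^sub>3 = sin z \<beta> - cos z a\<close> and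
  \<open>\<theta>\<^sub>4 = dz - b\<close>. Together with \<open>E\<^sub>1 = cos (z/2) h (cos t dx - sin t dy)\<close> and
  \<open>E\<^sub>2 = cos (z/2) h (sin t dx + cos t dy)\<close>, the forms \<open>E\<^sub>3 = \<theta>\<^sub>3\<close> and \<open>E\<^sub>4 = \<theta>\<^sub>4\<close> are an
  orthonormal coframe of \<open>g\<close>, and its structure equations have no explicit dependence on \<open>t\<close>.

  With \<open>\<tau> = tan (z/2) / 2\<close> and a suitable form \<open>C\<close> and functions \<open>m\<close>, \<open>\<gamma>\<close> they read

    \<open>dE\<^sub>1 = - C \<and> E\<^sub>2 - \<tau> E\<^sub>2 \<and> E\<^sub>3 + \<tau> E\<^sub>1 \<and> E\<^sub>4\<close>,

    \<open>dE\<^sub>2 = C \<and> E\<^sub>1 + \<tau> E\<^sub>1 \<and> E\<^sub>3 + \<tau> E\<^sub>2 \<and> E\<^sub>4\<close>,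

    \<open>dE\<^sub>3 = - 2 \<tau> E\<^sub>1 \<and> E\<^sub>2 - m E\<^sub>1 \<and> E\<^sub>4 - \<gamma> E\<^sub>3 \<and> E\<^sub>4\<close>,

    \<open>dE\<^sub>4 = m E\<^sub>1 \<and> E\<^sub>3\<close>

  (lemma \<open>extd1_coframe_in_coframe\<close>). For \<open>\<epsilon> = 1\<close> and \<open>\<epsilon> = - 1\<close> let \<open>J\<^sub>\<epsilon>\<close> send \<open>e\<^sub>1\<close> to \<open>e\<^sub>2\<close> and
  \<open>e\<^sub>3\<close> to \<open>\<epsilon> e\<^sub>4\<close>. The differentials of its (1,0)-forms \<open>E\<^sub>1 + i E\<^sub>2\<close> and \<open>E\<^sub>3 + i \<epsilon> E\<^sub>4\<close> have no
  (0,2)-part, so both structures are integrable (\<open>integrable_J\<close>). The Kaehler form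
  \<open>E\<^sub>1 \<and> E\<^sub>2 + \<epsilon> E\<^sub>3 \<and> E\<^sub>4\<close> has differential \<open>- 2 (1 + \<epsilon>) \<tau> E\<^sub>4 \<and> E\<^sub>1 \<and> E\<^sub>2\<close>
  (\<open>extd2_kaehler_form_J\<close>). It vanishes for \<open>\<epsilon> = - 1\<close>, which gives the Kaehler structure. For
  \<open>\<epsilon> = 1\<close> it is \<open>2 \<theta> \<and> \<Omega>\<close> with \<open>\<theta> = - tan (z/2) \<theta>\<^sub>4\<close>; this \<open>\<theta>\<close> is the only solution because
  wedging with \<open>\<Omega>\<close> is injective on one-forms (\<open>is_lee_form_iff\<close>), and \<open>d\<theta>\<close> has the
  coefficient \<open>tan (z/2) H cos t\<close> at \<open>dt \<and> dx\<close>, so \<open>\<theta>\<close> is not closed.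

  For the Ricci tensor, Cartan's structure equations turn the curvature into exterior derivatives
  of the connection forms (\<open>moving_frame.E_curvature\<close>, \<open>moving_frame.ricci_eq\<close>). Except for one
  function, the sectional curvature \<open>\<kappa>\<close> of the plane \<open>e\<^sub>1, e\<^sub>2\<close>, all coefficients of the curvature forms
  are constants (\<open>curvature_form_upper\<close>), and the trace is

    \<open>Ric = (\<kappa> + 1/2) (E\<^sub>1\<^sup>2 + E\<^sub>2\<^sup>2) + 3/2 (E\<^sub>3\<^sup>2 + E\<^sub>4\<^sup>2)\<close>.

  It is invariant under every orthogonal \<open>J\<close> that preserves the two planes.
\<close>

section \<open>Smooth functions\<close>

lemma dderiv_eq:
  assumes "(f has_derivative f') (at p)"
  shows "dderiv f p v = f' v"
  using frechet_derivative_at[OF assms] by (simp add: dderiv_def)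

lemma has_derivative_dderiv:
  assumes "f differentiable (at p)"
  shows "(f has_derivative dderiv f p) (at p)"
proof -
  have "dderiv f p = frechet_derivative f (at p)"
    by (rule ext) (simp add: dderiv_def)
  then show ?thesis
    using assms by (simp add: frechet_derivative_works)
qed

lemma linear_dderiv: "f differentiable (at p) \<Longrightarrow> linear (dderiv f p)"
  using has_derivative_dderiv has_derivative_linear by blast

lemma dderiv_cong_open:
  assumes "open S" "p \<in> S" "\<And>q. q \<in> S \<Longrightarrow> f q = g q"
  shows "dderiv f p v = dderiv g p v"
proof -
  have "(f has_derivative D) (at p) \<longleftrightarrow> (g has_derivative D) (at p)" for D
    using has_derivative_transform_within_open[OF _ assms(1,2)] assms(3) by metis
  then show ?thesis
    by (simp add: dderiv_def frechet_derivative_def)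
qed

lemma differentiable_cong_open:
  assumes "f differentiable (at p)" "open S" "p \<in> S" "\<And>q. q \<in> S \<Longrightarrow> f q = g q"
  shows "g differentiable (at p)"
  using assms has_derivative_transform_within_open[OF _ assms(2,3)] 
  unfolding differentiable_def by metis

lemma Ck_on_cong:
  assumes "open S" "\<And>q. q \<in> S \<Longrightarrow> f q = g q"
  shows "Ck_on k S f \<longleftrightarrow> Ck_on k S g"
  using assms(2)
proof (induction k arbitrary: f g)
  case 0
  then show ?case by (simp cong: continuous_on_cong)
next
  case (Suc k)
  have "Ck_on k S (\<lambda>p. dderiv f p v) \<longleftrightarrow> Ck_on k S (\<lambda>p. dderiv g p v)" for v
    using dderiv_cong_open[OF assms(1) _ Suc.prems] by (intro Suc.IH) simp
  moreover have "f differentiable (at p) \<longleftrightarrow> g differentiable (at p)" if "p \<in> S" for p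
    using differentiable_cong_open[OF _ assms(1) that] Suc.prems by metis
  ultimately show ?case by simp
qed

text \<open>The definition asks for differentiability at each order but for continuity only at the last
  one; so the inclusion of the classes needs an argument.\<close>

lemma Ck_on_SucD: "Ck_on (Suc k) S f \<Longrightarrow> Ck_on k S f"
proof (induction k arbitrary: f)
  case 0
  then show ?case
    by (auto intro!: continuous_at_imp_continuous_on differentiable_imp_continuous_within)
next
  case (Suc k)
  then show ?case by simp
qed

lemma Ck_on_const: "Ck_on k S (\<lambda>_. c)"
proof (induction k arbitrary: c)
  case (Suc k)
  have "(\<lambda>p. dderiv (\<lambda>_. c) p v) = (\<lambda>_. 0)" for v :: 'a and c :: 'b
    by (rule ext, rule dderiv_eq) simp
  then show ?case using Suc by simp
qed simp

lemma Ck_on_bounded_linear: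
  assumes L: "bounded_linear L"
  shows "Ck_on k S L"
proof (cases k)
  case 0
  then show ?thesis using L by (simp add: linear_continuous_on)
next
  case (Suc j)
  have D: "(L has_derivative L) (at p)" for p
    by (rule bounded_linear_imp_has_derivative[OF L])
  have "(\<lambda>p. dderiv L p v) = (\<lambda>_. L v)" for v
    by (rule ext, rule dderiv_eq[OF D])
  then show ?thesis using D by (auto simp: Suc Ck_on_const differentiable_def)
qed

lemma Ck_on_add:
  assumes "open S" "Ck_on k S f" "Ck_on k S g"
  shows "Ck_on k S (\<lambda>p. f p + g p)"
  using assms(2,3)
proof (induction k arbitrary: f g)
  case 0
  then show ?case by (simp add: continuous_on_add)
next
  case (Suc k)
  have D: "dderiv (\<lambda>p. f p + g p) p v = dderiv f p v + dderiv g p v" if "p \<in> S" for p v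
    by (rule dderiv_eq, rule has_derivative_add) (use Suc.prems that in \<open>auto intro: has_derivative_dderiv\<close>)
  have "Ck_on k S (\<lambda>p. dderiv (\<lambda>p. f p + g p) p v)" for v
    using Suc by (subst Ck_on_cong[OF assms(1) D]) auto
  then show ?case using Suc.prems by auto
qed

text \<open>The single product rule that covers multiplication, scaling and inner products.\<close>

lemma Ck_on_bilinear:
  assumes B: "bounded_bilinear B" and "open S" "Ck_on k S f" "Ck_on k S g"
  shows "Ck_on k S (\<lambda>p. B (f p) (g p))"
  using assms(3,4)
proof (induction k arbitrary: f g)
  case 0
  then show ?case by (simp add: bounded_bilinear.continuous_on[OF B])
next
  case (Suc k)
  have H: "((\<lambda>p. B (f p) (g p)) has_derivative
      (\<lambda>v. B (f p) (dderiv g p v) + B (dderiv f p v) (g p))) (at p)" if "p \<in> S" for p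
    by (rule bounded_bilinear.FDERIV[OF B]) (use Suc.prems that in \<open>auto intro: has_derivative_dderiv\<close>)
  have "Ck_on k S (\<lambda>p. dderiv (\<lambda>p. B (f p) (g p)) p v)" for v
    using Suc.prems Ck_on_SucD[OF Suc.prems(1)] Ck_on_SucD[OF Suc.prems(2)]
    by (subst Ck_on_cong[OF assms(2) dderiv_eq[OF H]]) (auto intro!: Ck_on_add assms(2) Suc.IH)
  then show ?case using H by (auto simp: differentiable_def)
qed

lemma Ck_on_sum:
  assumes "open S" "\<And>i. i \<in> I \<Longrightarrow> Ck_on k S (f i)"
  shows "Ck_on k S (\<lambda>p. \<Sum>i\<in>I. f i p)"
  using assms(2)
  by (induction I rule: infinite_finite_induct) (auto simp: Ck_on_const intro: Ck_on_add[OF assms(1)])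

text \<open>Expanding the inner derivative in an orthonormal basis turns the chain rule into a sum of
  products, so the induction only uses the product rule.\<close>

lemma Ck_on_compose:
  fixes g :: "'a::real_normed_vector \<Rightarrow> 'b::euclidean_space"
  assumes "open S" "open T" "g ` S \<subseteq> T" "Ck_on k T f" "Ck_on k S g"
  shows "Ck_on k S (\<lambda>p. f (g p))"
  using assms(4,5)
proof (induction k arbitrary: f)
  case 0
  then show ?case
    using assms(3) by (auto intro: continuous_on_compose2)
next
  case (Suc k)
  have f': "f differentiable (at (g p))" and g': "g differentiable (at p)" if "p \<in> S" for p
    using Suc.prems assms(3) that by auto
  have H: "((\<lambda>p. f (g p)) has_derivative (\<lambda>v. dderiv f (g p) (dderiv g p v))) (at p)"
    if "p \<in> S" for p
    by (rule has_derivative_compose[OF has_derivative_dderiv[OF g'[OF that]]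
          has_derivative_dderiv[OF f'[OF that]]])
  have D: "dderiv (\<lambda>p. f (g p)) p v = (\<Sum>b\<in>Basis. (dderiv g p v \<bullet> b) *\<^sub>R dderiv f (g p) b)"
    if "p \<in> S" for p v
  proof -
    have "linear (dderiv f (g p))"
      by (rule linear_dderiv[OF f'[OF that]])
    then show ?thesis
      unfolding dderiv_eq[OF H[OF that]]
      by (subst euclidean_representation[of "dderiv g p v", symmetric])
        (simp add: linear_sum linear_cmul)
  qed
  have "Ck_on k S (\<lambda>p. dderiv (\<lambda>p. f (g p)) p v)" for v
    by (subst Ck_on_cong[OF assms(1) D])
      (use Suc.prems in \<open>auto intro!: Ck_on_sum Ck_on_bilinear[OF bounded_bilinear_scaleR]
        Ck_on_bilinear[OF bounded_bilinear_inner] Ck_on_const assms(1)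
        Suc.IH[of "\<lambda>q. dderiv f q b" for b] intro: Ck_on_SucD\<close>)
  then show ?case using H by (auto simp: differentiable_def)
qed

lemma smooth_on_cong:
  assumes "open S" "\<And>q. q \<in> S \<Longrightarrow> f q = g q"
  shows "smooth_on S f \<longleftrightarrow> smooth_on S g"
  using Ck_on_cong[OF assms] by (simp add: smooth_on_def)

lemma smooth_on_imp_differentiable: "smooth_on S f \<Longrightarrow> p \<in> S \<Longrightarrow> f differentiable (at p)"
  unfolding smooth_on_def by (metis Ck_on.simps(2))

lemma smooth_on_dderiv: "smooth_on S f \<Longrightarrow> smooth_on S (\<lambda>p. dderiv f p v)"
  unfolding smooth_on_def by (metis Ck_on.simps(2))

lemma smooth_on_const: "smooth_on S (\<lambda>_. c)"
  by (simp add: smooth_on_def Ck_on_const)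

lemma smooth_on_bounded_linear: "bounded_linear L \<Longrightarrow> smooth_on S L"
  by (simp add: smooth_on_def Ck_on_bounded_linear)

lemma smooth_on_add:
  "open S \<Longrightarrow> smooth_on S f \<Longrightarrow> smooth_on S g \<Longrightarrow> smooth_on S (\<lambda>p. f p + g p)"
  by (simp add: smooth_on_def Ck_on_add)

lemma smooth_on_sum:
  "open S \<Longrightarrow> (\<And>i. i \<in> I \<Longrightarrow> smooth_on S (f i)) \<Longrightarrow> smooth_on S (\<lambda>p. \<Sum>i\<in>I. f i p)"
  by (simp add: smooth_on_def Ck_on_sum)

lemma smooth_on_scaleR:
  "open S \<Longrightarrow> smooth_on S f \<Longrightarrow> smooth_on S g \<Longrightarrow> smooth_on S (\<lambda>p. f p *\<^sub>R g p)"
  by (simp add: smooth_on_def Ck_on_bilinear[OF bounded_bilinear_scaleR])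

lemma smooth_on_mult:
  fixes f g :: "'a::real_normed_vector \<Rightarrow> real"
  shows "open S \<Longrightarrow> smooth_on S f \<Longrightarrow> smooth_on S g \<Longrightarrow> smooth_on S (\<lambda>p. f p * g p)"
  by (simp add: smooth_on_def Ck_on_bilinear[OF bounded_bilinear_mult])

lemma smooth_on_minus: "open S \<Longrightarrow> smooth_on S f \<Longrightarrow> smooth_on S (\<lambda>p. - f p)"
  using smooth_on_scaleR[OF _ smooth_on_const[of S "-1"]] by simp

lemma smooth_on_diff:
  "open S \<Longrightarrow> smooth_on S f \<Longrightarrow> smooth_on S g \<Longrightarrow> smooth_on S (\<lambda>p. f p - g p)"
  using smooth_on_add[OF _ _ smooth_on_minus] by fastforce

lemma smooth_on_power:
  fixes f :: "'a::real_normed_vector \<Rightarrow> real"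
  shows "open S \<Longrightarrow> smooth_on S f \<Longrightarrow> smooth_on S (\<lambda>p. f p ^ n)"
  by (induction n) (auto simp: smooth_on_const smooth_on_mult)

lemma smooth_on_compose:
  fixes g :: "'a::real_normed_vector \<Rightarrow> 'b::euclidean_space"
  assumes "open S" "open T" "g ` S \<subseteq> T" "smooth_on T f" "smooth_on S g"
  shows "smooth_on S (\<lambda>p. f (g p))"
  using assms by (auto simp: smooth_on_def intro: Ck_on_compose)

lemma smooth_on_Pair:
  fixes f :: "'a::real_normed_vector \<Rightarrow> 'b::euclidean_space"
    and g :: "'a \<Rightarrow> 'c::euclidean_space"
  assumes "open S" "smooth_on S f" "smooth_on S g"
  shows "smooth_on S (\<lambda>p. (f p, g p))"
proof -
  have "bounded_linear (\<lambda>x. (x::'b, 0::'c))" "bounded_linear (\<lambda>x. (0::'b, x::'c))"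
    by (auto intro!: bounded_linear_Pair bounded_linear_ident bounded_linear_zero)
  then have "smooth_on S (\<lambda>p. (f p, 0::'c))" "smooth_on S (\<lambda>p. (0::'b, g p))"
    using smooth_on_compose[OF assms(1) open_UNIV _ smooth_on_bounded_linear] assms(2,3)
    by blast+
  from smooth_on_add[OF assms(1) this] show ?thesis by simp
qed

lemma smooth_on_sin_cos: "smooth_on UNIV (sin :: real \<Rightarrow> real)" "smooth_on UNIV (cos :: real \<Rightarrow> real)"
proof -
  have D: "(sin has_derivative (\<lambda>v. cos x * v)) (at x)" "(cos has_derivative (\<lambda>v. - sin x * v)) (at x)"
    for x :: real
    by (auto intro!: derivative_eq_intros)
  have "Ck_on k UNIV (sin :: real \<Rightarrow> real) \<and> Ck_on k UNIV (cos :: real \<Rightarrow> real)" for k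
  proof (induction k)
    case 0
    then show ?case by (auto intro: continuous_intros)
  next
    case (Suc k)
    then have "Ck_on k UNIV (\<lambda>x. cos x * v)" "Ck_on k UNIV (\<lambda>x. (- 1) * sin x * v)" for v :: real
      by (intro Ck_on_bilinear[OF bounded_bilinear_mult] Ck_on_const open_UNIV; simp)+
    moreover have "(\<lambda>x. dderiv sin x v) = (\<lambda>x. cos x * v)"
      "(\<lambda>x. dderiv cos x v) = (\<lambda>x. (- 1) * sin x * v)" for v :: real
      by (rule ext, simp add: dderiv_eq[OF D(1)] dderiv_eq[OF D(2)])+
    moreover have "sin differentiable (at x)" "cos differentiable (at x)" for x :: real
      using D unfolding differentiable_def by blast+
    ultimately show ?case by simp
  qed
  then show "smooth_on UNIV (sin :: real \<Rightarrow> real)" "smooth_on UNIV (cos :: real \<Rightarrow> real)"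
    by (auto simp: smooth_on_def)
qed

lemma smooth_on_inverse_real: "smooth_on (- {0}) (inverse :: real \<Rightarrow> real)"
proof -
  have D: "(inverse has_derivative (\<lambda>v. - v * (inverse x * inverse x))) (at x)" if "x \<in> -{0}" for x :: real
    using that by (auto intro!: derivative_eq_intros)
  have "Ck_on k (-{0}) (inverse :: real \<Rightarrow> real)" for k
  proof (induction k)
    case 0
    then show ?case by (auto intro: continuous_intros)
  next
    case (Suc k)
    have "Ck_on k (-{0}) (\<lambda>x. dderiv (inverse :: real \<Rightarrow> real) x v)" for v
    proof -
      have "open (- {0::real})" by auto
      moreover have "Ck_on k (- {0}) (\<lambda>x. - v * (inverse x * inverse x))"
        by (intro Ck_on_bilinear[OF bounded_bilinear_mult] Ck_on_const Suc calculation)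
      moreover have "Ck_on k (- {0}) (\<lambda>x. dderiv (inverse :: real \<Rightarrow> real) x v) \<longleftrightarrow>
          Ck_on k (- {0}) (\<lambda>x. - v * (inverse x * inverse x))"
        by (rule Ck_on_cong) (use dderiv_eq[OF D] in auto)
      ultimately show ?thesis by blast
    qed
    moreover have "inverse differentiable (at x)" if "x \<in> -{0}" for x :: real
      using D[OF that] unfolding differentiable_def by blast
    ultimately show ?case by simp
  qed
  then show ?thesis by (simp add: smooth_on_def)
qed

lemma smooth_on_ln_real: "smooth_on {0<..} (ln :: real \<Rightarrow> real)"
proof -
  have D: "(ln has_derivative (\<lambda>v. v * inverse x)) (at x)" if "x \<in> {0<..}" for x :: real
    using that by (auto intro!: derivative_eq_intros simp: field_simps)
  have "smooth_on {0<..} (\<lambda>x::real. inverse x)"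
    by (rule smooth_on_compose[OF _ _ _ smooth_on_inverse_real])
      (auto intro: smooth_on_bounded_linear bounded_linear_ident)
  then have "smooth_on {0<..} (\<lambda>x. v * inverse x)" for v :: real
    by (intro smooth_on_mult smooth_on_const open_greaterThan)
  moreover have "smooth_on {0<..} (\<lambda>x. dderiv (ln :: real \<Rightarrow> real) x v) \<longleftrightarrow>
      smooth_on {0<..} (\<lambda>x. v * inverse x)" for v
    by (rule smooth_on_cong) (use dderiv_eq[OF D] in auto)
  ultimately have "Ck_on k {0<..} (\<lambda>x. dderiv (ln :: real \<Rightarrow> real) x v)" for k v
    unfolding smooth_on_def by blast
  moreover have "ln differentiable (at x)" if "x \<in> {0<..}" for x :: real
    using D[OF that] unfolding differentiable_def by blast
  ultimately have "Ck_on (Suc k) {0<..} (ln :: real \<Rightarrow> real)" for k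
    by simp
  then show ?thesis unfolding smooth_on_def using Ck_on_SucD by blast
qed

context
  fixes S :: "'a::real_normed_vector set" and f :: "'a \<Rightarrow> real"
  assumes S: "open S" and f: "smooth_on S f"
begin

lemma smooth_on_sin: "smooth_on S (\<lambda>p. sin (f p))"
  by (rule smooth_on_compose[OF S _ _ smooth_on_sin_cos(1) f]) auto

lemma smooth_on_cos: "smooth_on S (\<lambda>p. cos (f p))"
  by (rule smooth_on_compose[OF S _ _ smooth_on_sin_cos(2) f]) auto

lemma smooth_on_ln: "(\<And>p. p \<in> S \<Longrightarrow> f p > 0) \<Longrightarrow> smooth_on S (\<lambda>p. ln (f p))"
  by (rule smooth_on_compose[OF S _ _ smooth_on_ln_real f]) auto

lemma smooth_on_divide:
  assumes "smooth_on S g" "\<And>p. p \<in> S \<Longrightarrow> f p \<noteq> 0"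
  shows "smooth_on S (\<lambda>p. g p / f p)"
proof -
  have "smooth_on S (\<lambda>p. inverse (f p))"
    by (rule smooth_on_compose[OF S _ _ smooth_on_inverse_real f]) (use assms(2) in auto)
  from smooth_on_mult[OF S assms(1) this] show ?thesis by (simp add: divide_inverse)
qed

end

lemmas smooth_intros = smooth_on_const smooth_on_add smooth_on_diff smooth_on_minus
  smooth_on_mult smooth_on_scaleR smooth_on_power smooth_on_sum smooth_on_sin smooth_on_cos
  smooth_on_ln smooth_on_divide smooth_on_Pair

section \<open>Symmetry of second derivatives\<close>

lemma has_real_derivative_along_line:
  fixes f :: "'a::real_normed_vector \<Rightarrow> real"
  assumes "f differentiable (at (w + s *\<^sub>R u))"
  shows "((\<lambda>s. f (w + s *\<^sub>R u)) has_real_derivative dderiv f (w + s *\<^sub>R u) u) (at s)"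
proof -
  have "((\<lambda>s. w + s *\<^sub>R u) has_derivative (\<lambda>r. r *\<^sub>R u)) (at s)"
    by (auto intro!: derivative_eq_intros)
  from has_derivative_compose[OF this has_derivative_dderiv[OF assms]]
  show ?thesis
    using linear_cmul[OF linear_dderiv[OF assms]]
    by (simp add: has_field_derivative_def mult.commute[of _ "dderiv f _ u"])
qed

text \<open>Two applications of the mean value theorem express the second difference of a function
  over a small parallelogram by an iterated derivative at an interior point. The second difference
  is symmetric in the two directions.\<close>

lemma second_difference_mean_value:
  fixes f :: "'a::real_normed_vector \<Rightarrow> real"
  assumes "e > 0" and C2: "Ck_on 2 S f"
    and S: "\<And>s t. 0 \<le> s \<Longrightarrow> s \<le> e \<Longrightarrow> 0 \<le> t \<Longrightarrow> t \<le> e \<Longrightarrow> p + s *\<^sub>R u + t *\<^sub>R v \<in> S"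
  obtains s t where "0 < s" "s < e" "0 < t" "t < e"
    "f (p + e *\<^sub>R u + e *\<^sub>R v) - f (p + e *\<^sub>R u) - f (p + e *\<^sub>R v) + f p =
      e * e * dderiv (\<lambda>q. dderiv f q u) (p + s *\<^sub>R u + t *\<^sub>R v) v"
proof -
  have C: "f differentiable (at q)" "(\<lambda>q. dderiv f q w) differentiable (at q)" if "q \<in> S" for q w
    using C2 that by (auto simp: numeral_2_eq_2)
  define \<phi> where "\<phi> s = f ((p + e *\<^sub>R v) + s *\<^sub>R u) - f (p + s *\<^sub>R u)" for s
  have "\<exists>s. 0 < s \<and> s < e \<and> \<phi> e - \<phi> 0 = (e - 0) *
     (dderiv f ((p + e *\<^sub>R v) + s *\<^sub>R u) u - dderiv f (p + s *\<^sub>R u) u)"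
  proof (rule MVT2)
    fix s assume "0 \<le> s" "s \<le> e"
    then show "(\<phi> has_real_derivative
        dderiv f ((p + e *\<^sub>R v) + s *\<^sub>R u) u - dderiv f (p + s *\<^sub>R u) u) (at s)"
      using S[of s e] S[of s 0] \<open>e > 0\<close> unfolding \<phi>_def
      by (intro DERIV_diff has_real_derivative_along_line C) (auto simp: algebra_simps)
  qed (use \<open>e > 0\<close> in auto)
  then obtain s where s: "0 < s" "s < e" "\<phi> e - \<phi> 0 = e *
     (dderiv f ((p + s *\<^sub>R u) + e *\<^sub>R v) u - dderiv f (p + s *\<^sub>R u) u)"
    by (auto simp: algebra_simps)
  have "\<exists>t. 0 < t \<and> t < e \<and>
      dderiv f ((p + s *\<^sub>R u) + e *\<^sub>R v) u - dderiv f ((p + s *\<^sub>R u) + 0 *\<^sub>R v) u =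
      (e - 0) * dderiv (\<lambda>q. dderiv f q u) ((p + s *\<^sub>R u) + t *\<^sub>R v) v"
  proof (rule MVT2)
    fix t assume "0 \<le> t" "t \<le> e"
    then show "((\<lambda>t. dderiv f ((p + s *\<^sub>R u) + t *\<^sub>R v) u) has_real_derivative
        dderiv (\<lambda>q. dderiv f q u) ((p + s *\<^sub>R u) + t *\<^sub>R v) v) (at t)"
      using S[of s t] s by (intro has_real_derivative_along_line C) auto
  qed (use \<open>e > 0\<close> in auto)
  then obtain t where t: "0 < t" "t < e"
      "dderiv f ((p + s *\<^sub>R u) + e *\<^sub>R v) u - dderiv f (p + s *\<^sub>R u) u =
      e * dderiv (\<lambda>q. dderiv f q u) ((p + s *\<^sub>R u) + t *\<^sub>R v) v"
    by auto
  show ?thesis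
    by (rule that[OF s(1,2) t(1,2)]) (use s(3) t(3) in \<open>simp add: \<phi>_def algebra_simps\<close>)
qed

text \<open>If the two iterated derivatives differed at \<open>p\<close>, then by continuity they would also take
  different values at any two points close to \<open>p\<close>; but the second difference over a small
  parallelogram equates two such values.\<close>

lemma dderiv_dderiv_commute:
  fixes f :: "'a::real_normed_vector \<Rightarrow> real"
  assumes "open S" "p \<in> S" and C2: "Ck_on 2 S f"
  shows "dderiv (\<lambda>q. dderiv f q u) p v = dderiv (\<lambda>q. dderiv f q v) p u"
proof (rule ccontr)
  define F where "F u v q = dderiv (\<lambda>q. dderiv f q u) q v" for u v q
  assume "\<not> ?thesis"
  then have "F u v p \<noteq> F v u p" by (simp add: F_def)
  then have \<epsilon>: "dist (F u v p) (F v u p) / 2 > 0" (is "?\<epsilon> > 0") by simp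
  have "continuous_on S (F u v)" for u v
    using C2 by (auto simp: F_def numeral_2_eq_2)
  then have cont: "isCont (F u v) p" for u v
    using assms by (simp add: continuous_on_eq_continuous_at)
  obtain d1 where d1: "d1 > 0" "\<And>q. dist q p < d1 \<Longrightarrow> dist (F u v q) (F u v p) < ?\<epsilon>"
    using cont \<epsilon> unfolding continuous_at_eps_delta by metis
  obtain d2 where d2: "d2 > 0" "\<And>q. dist q p < d2 \<Longrightarrow> dist (F v u q) (F v u p) < ?\<epsilon>"
    using cont \<epsilon> unfolding continuous_at_eps_delta by metis
  obtain d3 where d3: "d3 > 0" "ball p d3 \<subseteq> S"
    using assms open_contains_ball by blast
  \<comment> \<open>The side length \<open>e\<close> keeps the whole parallelogram within distance \<open>d\<close> of \<open>p\<close>; the summand 1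
    avoids division by zero.\<close>
  define d where "d = min d1 (min d2 d3)"
  define e where "e = d / (1 + norm u + norm v)"
  have pos: "1 + norm u + norm v > 0" by (simp add: add_pos_nonneg)
  have "d > 0" using d1 d2 d3 by (simp add: d_def)
  then have "e > 0" using pos by (simp add: e_def)
  have near: "dist (p + s *\<^sub>R u' + t *\<^sub>R v') p < d"
    if "0 \<le> s" "s \<le> e" "0 \<le> t" "t \<le> e" "{u', v'} = {u, v}" for s t u' v'
  proof -
    have "norm (s *\<^sub>R u' + t *\<^sub>R v') \<le> s * norm u' + t * norm v'"
      using that norm_triangle_ineq[of "s *\<^sub>R u'" "t *\<^sub>R v'"] by simp
    also have "\<dots> \<le> e * norm u' + e * norm v'"
      using that by (intro add_mono mult_right_mono) auto
    also have "\<dots> = e * (norm u + norm v)"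
      using that(5) by (auto simp: doubleton_eq_iff algebra_simps)
    also have "\<dots> < e * (1 + norm u + norm v)"
      using \<open>e > 0\<close> by simp
    also have "\<dots> = d" using pos by (simp add: e_def)
    finally show ?thesis by (simp add: dist_norm add.assoc)
  qed
  have inS: "p + s *\<^sub>R u' + t *\<^sub>R v' \<in> S"
    if "0 \<le> s" "s \<le> e" "0 \<le> t" "t \<le> e" "{u', v'} = {u, v}" for s t u' v'
    using near[OF that] d3 by (auto simp: d_def dist_commute subset_eq)
  obtain s t where 1: "0 < s" "s < e" "0 < t" "t < e"
    "f (p + e *\<^sub>R u + e *\<^sub>R v) - f (p + e *\<^sub>R u) - f (p + e *\<^sub>R v) + f p =
      e * e * F u v (p + s *\<^sub>R u + t *\<^sub>R v)"
    unfolding F_def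
    by (rule second_difference_mean_value[OF \<open>e > 0\<close> C2, of p u v]) (auto intro: inS)
  obtain s' t' where 2: "0 < s'" "s' < e" "0 < t'" "t' < e"
    "f (p + e *\<^sub>R v + e *\<^sub>R u) - f (p + e *\<^sub>R v) - f (p + e *\<^sub>R u) + f p =
      e * e * F v u (p + s' *\<^sub>R v + t' *\<^sub>R u)"
    unfolding F_def
    by (rule second_difference_mean_value[OF \<open>e > 0\<close> C2, of p v u]) (auto intro: inS)
  have "e * e * F u v (p + s *\<^sub>R u + t *\<^sub>R v) = e * e * F v u (p + s' *\<^sub>R v + t' *\<^sub>R u)"
    unfolding 1(5)[symmetric] 2(5)[symmetric] by (simp add: algebra_simps)
  then have "F u v (p + s *\<^sub>R u + t *\<^sub>R v) = F v u (p + s' *\<^sub>R v + t' *\<^sub>R u)"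
    using \<open>e > 0\<close> by simp
  moreover have "dist (F u v (p + s *\<^sub>R u + t *\<^sub>R v)) (F u v p) < ?\<epsilon>"
    using near[of s t u v] 1 by (intro d1) (simp add: d_def)
  moreover have "dist (F v u (p + s' *\<^sub>R v + t' *\<^sub>R u)) (F v u p) < ?\<epsilon>"
    using near[of s' t' v u] 2 by (intro d2) (simp add: d_def insert_commute)
  ultimately show False
    by (metis dist_commute dist_triangle_half_l less_irrefl)
qed

section \<open>Exterior derivatives and the Nijenhuis tensor\<close>

lemma linear_expand_Basis:
  fixes v :: "'a::euclidean_space"
  assumes "linear L"
  shows "L v = (\<Sum>b\<in>Basis. (v \<bullet> b) *\<^sub>R L b)"
  by (subst euclidean_representation[of v, symmetric]) (simp only: linear_sum[OF assms] linear_cmul[OF assms])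

lemma smooth_on_apply:
  fixes A :: "'a::real_normed_vector \<Rightarrow> 'b::euclidean_space \<Rightarrow> 'c::real_normed_vector"
  assumes "open S" "\<And>q. q \<in> S \<Longrightarrow> linear (A q)" "\<And>v. smooth_on S (\<lambda>q. A q v)" "smooth_on S Y"
  shows "smooth_on S (\<lambda>q. A q (Y q))"
proof -
  have L: "smooth_on S (\<lambda>q. Y q \<bullet> b)" for b
    using assms(4) unfolding smooth_on_def
    by (auto intro: Ck_on_bilinear[OF bounded_bilinear_inner assms(1)] Ck_on_const)
  show ?thesis
    by (subst smooth_on_cong[OF assms(1) linear_expand_Basis[OF assms(2)]])
      (auto intro!: smooth_on_sum smooth_on_scaleR assms L)
qed

text \<open>Leibniz rule for a field of linear maps applied to a vector field.\<close>

lemma has_derivative_apply: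
  fixes A :: "'a::real_normed_vector \<Rightarrow> 'b::euclidean_space \<Rightarrow> 'c::real_normed_vector"
  assumes S: "open S" "p \<in> S" "\<And>q. q \<in> S \<Longrightarrow> linear (A q)"
    and A: "\<And>v. (\<lambda>q. A q v) differentiable (at p)" and Y: "Y differentiable (at p)"
  shows "((\<lambda>q. A q (Y q)) has_derivative
    (\<lambda>u. dderiv (\<lambda>q. A q (Y p)) p u + A p (dderiv Y p u))) (at p)"
proof -
  have DA: "((\<lambda>q. A q v) has_derivative dderiv (\<lambda>q. A q v) p) (at p)" for v
    using A by (rule has_derivative_dderiv)
  have "((\<lambda>q. \<Sum>b\<in>Basis. (Y q \<bullet> b) *\<^sub>R A q b) has_derivative
      (\<lambda>u. \<Sum>b\<in>Basis. (Y p \<bullet> b) *\<^sub>R dderiv (\<lambda>q. A q b) p u + (dderiv Y p u \<bullet> b) *\<^sub>R A p b)) (at p)"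
    by (intro has_derivative_sum has_derivative_scaleR has_derivative_inner_left
        has_derivative_dderiv Y A)
  then have "((\<lambda>q. A q (Y q)) has_derivative
      (\<lambda>u. \<Sum>b\<in>Basis. (Y p \<bullet> b) *\<^sub>R dderiv (\<lambda>q. A q b) p u + (dderiv Y p u \<bullet> b) *\<^sub>R A p b)) (at p)"
    by (rule has_derivative_transform_within_open[OF _ S(1,2)])
      (metis linear_expand_Basis[OF S(3)])
  moreover have "(\<Sum>b\<in>Basis. (Y p \<bullet> b) *\<^sub>R dderiv (\<lambda>q. A q b) p u + (dderiv Y p u \<bullet> b) *\<^sub>R A p b) =
      dderiv (\<lambda>q. A q (Y p)) p u + A p (dderiv Y p u)" for u
  proof -
    have "((\<lambda>q. \<Sum>b\<in>Basis. (Y p \<bullet> b) *\<^sub>R A q b) has_derivative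
        (\<lambda>u. \<Sum>b\<in>Basis. (Y p \<bullet> b) *\<^sub>R dderiv (\<lambda>q. A q b) p u)) (at p)"
      by (intro has_derivative_sum has_derivative_scaleR_right DA)
    moreover have "dderiv (\<lambda>q. A q (Y p)) p u = dderiv (\<lambda>q. \<Sum>b\<in>Basis. (Y p \<bullet> b) *\<^sub>R A q b) p u"
      by (rule dderiv_cong_open[OF S(1,2)]) (rule linear_expand_Basis[OF S(3)])
    ultimately have "dderiv (\<lambda>q. A q (Y p)) p u =
        (\<Sum>b\<in>Basis. (Y p \<bullet> b) *\<^sub>R dderiv (\<lambda>q. A q b) p u)"
      by (simp add: dderiv_eq)
    moreover have "A p (dderiv Y p u) = (\<Sum>b\<in>Basis. (dderiv Y p u \<bullet> b) *\<^sub>R A p b)"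
      by (rule linear_expand_Basis[OF S(3)[OF S(2)]])
    ultimately show ?thesis by (simp add: sum.distrib)
  qed
  ultimately show ?thesis by simp
qed

lemma extd1_scale:
  assumes "f differentiable (at p)" "\<And>v. (\<lambda>q. \<alpha> q v) differentiable (at p)"
  shows "extd1 (\<lambda>q v. f q * \<alpha> q v) p u v = wedge11 (dderiv f p) (\<alpha> p) u v + f p * extd1 \<alpha> p u v"
proof -
  have "dderiv (\<lambda>q. f q * \<alpha> q v) p u = f p * dderiv (\<lambda>q. \<alpha> q v) p u + dderiv f p u * \<alpha> p v" for u v
    by (rule dderiv_eq) (intro has_derivative_mult has_derivative_dderiv assms)
  then show ?thesis by (simp add: extd1_def wedge11_def algebra_simps)
qed

lemma extd1_cong_open:
  assumes "open S" "p \<in> S" "\<And>q v. q \<in> S \<Longrightarrow> \<alpha> q v = \<beta> q v"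
  shows "extd1 \<alpha> p u v = extd1 \<beta> p u v"
proof -
  have "dderiv (\<lambda>q. \<alpha> q v) p u = dderiv (\<lambda>q. \<beta> q v) p u" for u v
    by (rule dderiv_cong_open[OF assms(1,2)]) (rule assms(3))
  then show ?thesis by (simp add: extd1_def)
qed

lemma extd2_cong_open:
  assumes "open S" "p \<in> S" "\<And>q v w. q \<in> S \<Longrightarrow> \<alpha> q v w = \<beta> q v w"
  shows "extd2 \<alpha> p u v w = extd2 \<beta> p u v w"
proof -
  have "dderiv (\<lambda>q. \<alpha> q v w) p u = dderiv (\<lambda>q. \<beta> q v w) p u" for u v w
    by (rule dderiv_cong_open[OF assms(1,2)]) (rule assms(3))
  then show ?thesis by (simp add: extd2_def)
qed

lemma extd2_add:
  assumes "\<And>v w. (\<lambda>q. \<alpha> q v w) differentiable (at p)" "\<And>v w. (\<lambda>q. \<beta> q v w) differentiable (at p)"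
  shows "extd2 (\<lambda>q v w. \<alpha> q v w + \<beta> q v w) p u v w = extd2 \<alpha> p u v w + extd2 \<beta> p u v w"
proof -
  have "dderiv (\<lambda>q. \<alpha> q v w + \<beta> q v w) p u =
      dderiv (\<lambda>q. \<alpha> q v w) p u + dderiv (\<lambda>q. \<beta> q v w) p u" for u v w
    by (rule dderiv_eq) (intro has_derivative_add has_derivative_dderiv assms)
  then show ?thesis by (simp add: extd2_def)
qed

lemma extd2_wedge11:
  assumes "\<And>v. (\<lambda>q. \<alpha> q v) differentiable (at p)" "\<And>v. (\<lambda>q. \<beta> q v) differentiable (at p)"
  shows "extd2 (\<lambda>q. wedge11 (\<alpha> q) (\<beta> q)) p u v w =
    wedge12 (\<beta> p) (extd1 \<alpha> p) u v w - wedge12 (\<alpha> p) (extd1 \<beta> p) u v w"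
proof -
  have D: "dderiv (\<lambda>q. wedge11 (\<alpha> q) (\<beta> q) v w) p u =
      \<alpha> p v * dderiv (\<lambda>q. \<beta> q w) p u + dderiv (\<lambda>q. \<alpha> q v) p u * \<beta> p w
      - (\<alpha> p w * dderiv (\<lambda>q. \<beta> q v) p u + dderiv (\<lambda>q. \<alpha> q w) p u * \<beta> p v)" for u v w
    unfolding wedge11_def
    by (rule dderiv_eq) (intro has_derivative_diff has_derivative_mult has_derivative_dderiv assms)
  show ?thesis unfolding extd2_def extd1_def wedge12_def D by algebra
qed

lemma smooth_form1_differentiable:
  "smooth_form1 M \<alpha> \<Longrightarrow> p \<in> M \<Longrightarrow> (\<lambda>q. \<alpha> q v) differentiable (at p)"
  unfolding smooth_form1_def using smooth_on_imp_differentiable by blast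

lemma smooth_form1_scale:
  "open M \<Longrightarrow> smooth_on M f \<Longrightarrow> smooth_form1 M \<alpha> \<Longrightarrow> smooth_form1 M (\<lambda>p v. f p * \<alpha> p v)"
  by (auto simp: smooth_form1_def linear_iff algebra_simps intro!: smooth_on_mult)

lemma smooth_form1_add:
  "open M \<Longrightarrow> smooth_form1 M \<alpha> \<Longrightarrow> smooth_form1 M \<beta> \<Longrightarrow> smooth_form1 M (\<lambda>p v. \<alpha> p v + \<beta> p v)"
  by (auto simp: smooth_form1_def linear_compose_add smooth_on_add)

lemma smooth_form1_diff:
  "open M \<Longrightarrow> smooth_form1 M \<alpha> \<Longrightarrow> smooth_form1 M \<beta> \<Longrightarrow> smooth_form1 M (\<lambda>p v. \<alpha> p v - \<beta> p v)"
  by (auto simp: smooth_form1_def linear_compose_sub smooth_on_diff)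

lemma smooth_form1_const: "linear L \<Longrightarrow> smooth_form1 M (\<lambda>_. L)"
  by (simp add: smooth_form1_def smooth_on_const)

lemma smooth_form1_zero: "smooth_form1 M (\<lambda>_ _. 0)"
  by (rule smooth_form1_const) (auto intro: linearI)

lemma extd1_const: "extd1 (\<lambda>_. L) p u v = 0"
  by (simp add: extd1_def dderiv_eq[OF has_derivative_const])

context
  fixes M :: "'a::euclidean_space set" and p :: 'a and \<alpha> \<beta> :: "'a form1"
  assumes p: "p \<in> M" and \<alpha>: "smooth_form1 M \<alpha>" and \<beta>: "smooth_form1 M \<beta>"
begin

lemma extd1_add: "extd1 (\<lambda>q v. \<alpha> q v + \<beta> q v) p u v = extd1 \<alpha> p u v + extd1 \<beta> p u v"
proof -
  have "dderiv (\<lambda>q. \<alpha> q v + \<beta> q v) p u = dderiv (\<lambda>q. \<alpha> q v) p u + dderiv (\<lambda>q. \<beta> q v) p u" for u v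
    by (rule dderiv_eq)
      (intro has_derivative_add has_derivative_dderiv smooth_form1_differentiable[OF _ p] \<alpha> \<beta>)
  then show ?thesis by (simp add: extd1_def)
qed

lemma extd1_minus: "extd1 (\<lambda>q v. - \<alpha> q v) p u v = - extd1 \<alpha> p u v"
proof -
  have "dderiv (\<lambda>q. - \<alpha> q v) p u = - dderiv (\<lambda>q. \<alpha> q v) p u" for u v
    by (rule dderiv_eq)
      (intro has_derivative_minus has_derivative_dderiv smooth_form1_differentiable[OF _ p] \<alpha>)
  then show ?thesis by (simp add: extd1_def)
qed

lemma extd1_diff: "extd1 (\<lambda>q v. \<alpha> q v - \<beta> q v) p u v = extd1 \<alpha> p u v - extd1 \<beta> p u v"
proof -
  have "dderiv (\<lambda>q. \<alpha> q v - \<beta> q v) p u = dderiv (\<lambda>q. \<alpha> q v) p u - dderiv (\<lambda>q. \<beta> q v) p u" for u v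
    by (rule dderiv_eq)
      (intro has_derivative_diff has_derivative_dderiv smooth_form1_differentiable[OF _ p] \<alpha> \<beta>)
  then show ?thesis by (simp add: extd1_def)
qed

end

text \<open>Cartan's formula for arbitrary vector fields; \<^const>\<open>extd1\<close> is defined by constant
  ones.\<close>

lemma extd1_vector_fields:
  assumes "open M" "p \<in> M" "smooth_form1 M \<alpha>" "X differentiable (at p)" "Y differentiable (at p)"
  shows "extd1 \<alpha> p (X p) (Y p) =
    dderiv (\<lambda>q. \<alpha> q (Y q)) p (X p) - dderiv (\<lambda>q. \<alpha> q (X q)) p (Y p) - \<alpha> p (lie_bracket X Y p)"
proof -
  have \<alpha>: "\<And>q. q \<in> M \<Longrightarrow> linear (\<alpha> q)" "\<And>v. (\<lambda>q. \<alpha> q v) differentiable (at p)"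
    using assms(2,3) smooth_form1_differentiable by (auto simp: smooth_form1_def)
  have D: "dderiv (\<lambda>q. \<alpha> q (Z q)) p w = dderiv (\<lambda>q. \<alpha> q (Z p)) p w + \<alpha> p (dderiv Z p w)"
    if "Z differentiable (at p)" for Z w
    by (rule dderiv_eq, rule has_derivative_apply[OF assms(1,2)]) (use \<alpha> that in auto)
  show ?thesis
    unfolding D[OF assms(4)] D[OF assms(5)] extd1_def lie_bracket_def
    using linear_diff[OF \<alpha>(1)[OF assms(2)]] by simp
qed

text \<open>Evaluating the Nijenhuis tensor on a covector, all derivatives of the two vector fields
  cancel by Cartan's formula. What remains is pointwise in the exterior derivatives of the covector
  field and of its image under the transpose of \<open>J\<close>.\<close>

lemma nijenhuis_covector:
  assumes M: "open M" "p \<in> M" and J: "almost_complex_structure M J"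
    and \<alpha>: "smooth_form1 M \<alpha>" and \<alpha>': "smooth_form1 M \<alpha>'"
    and \<alpha>'_eq: "\<And>q v. q \<in> M \<Longrightarrow> \<alpha> q (J q v) = \<alpha>' q v"
    and X: "smooth_on M X" and Y: "smooth_on M Y"
  shows "\<alpha> p (nijenhuis J X Y p) =
    extd1 \<alpha> p (X p) (Y p) - extd1 \<alpha> p (J p (X p)) (J p (Y p))
    + extd1 \<alpha>' p (J p (X p)) (Y p) + extd1 \<alpha>' p (X p) (J p (Y p))"
proof -
  have Jlin: "\<And>q. q \<in> M \<Longrightarrow> linear (J q)" and JJ: "\<And>q v. q \<in> M \<Longrightarrow> J q (J q v) = - v"
    and Js: "\<And>v. smooth_on M (\<lambda>q. J q v)"
    using J by (auto simp: almost_complex_structure_def)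
  define JX where "JX q = J q (X q)" for q
  define JY where "JY q = J q (Y q)" for q
  have d: "X differentiable (at p)" "Y differentiable (at p)"
    "JX differentiable (at p)" "JY differentiable (at p)"
    unfolding JX_def JY_def
    using smooth_on_apply[OF M(1) Jlin Js] X Y smooth_on_imp_differentiable M(2) by blast+
  have lin: "linear (\<alpha> q)" "linear (\<alpha>' q)" if "q \<in> M" for q
    using \<alpha> \<alpha>' that by (auto simp: smooth_form1_def)
  have \<alpha>'J: "\<alpha>' q (J q v) = - \<alpha> q v" if "q \<in> M" for q v
    using \<alpha>'_eq[OF that] JJ[OF that] linear_neg[OF lin(1)[OF that]] by metis
  have swap: "dderiv (\<lambda>q. \<alpha> q (JY q)) p u = dderiv (\<lambda>q. \<alpha>' q (Y q)) p u"
    "dderiv (\<lambda>q. \<alpha> q (JX q)) p u = dderiv (\<lambda>q. \<alpha>' q (X q)) p u" for u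
    by (rule dderiv_cong_open[OF M]; simp add: JX_def JY_def \<alpha>'_eq)+
  have neg: "dderiv (\<lambda>q. \<alpha>' q (J q (Z q))) p u = - dderiv (\<lambda>q. \<alpha> q (Z q)) p u"
    if "Z differentiable (at p)" for Z u
  proof -
    have "dderiv (\<lambda>q. \<alpha>' q (J q (Z q))) p u = dderiv (\<lambda>q. - \<alpha> q (Z q)) p u"
      by (rule dderiv_cong_open[OF M]) (rule \<alpha>'J)
    moreover have "(\<lambda>q. \<alpha> q (Z q)) differentiable (at p)"
      using has_derivative_apply[OF M lin(1) smooth_form1_differentiable[OF \<alpha> M(2)] that]
      by (auto simp: differentiable_def)
    ultimately show ?thesis
      by (simp add: dderiv_eq[OF has_derivative_minus[OF has_derivative_dderiv]])
  qed
  have neg': "dderiv (\<lambda>q. \<alpha>' q (JX q)) p u = - dderiv (\<lambda>q. \<alpha> q (X q)) p u"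
    "dderiv (\<lambda>q. \<alpha>' q (JY q)) p u = - dderiv (\<lambda>q. \<alpha> q (Y q)) p u" for u
    unfolding JX_def JY_def by (rule neg d)+
  note C = extd1_vector_fields[OF M \<alpha>] extd1_vector_fields[OF M \<alpha>']
  have "\<alpha> p (nijenhuis J X Y p) = \<alpha> p (lie_bracket JX JY p) - \<alpha>' p (lie_bracket JX Y p)
      - \<alpha>' p (lie_bracket X JY p) - \<alpha> p (lie_bracket X Y p)"
    using \<alpha>'_eq[OF M(2)] linear_diff[OF lin(1)[OF M(2)]]
    by (simp add: nijenhuis_def JX_def[abs_def] JY_def[abs_def])
  also have "\<dots> = extd1 \<alpha> p (X p) (Y p) - extd1 \<alpha> p (JX p) (JY p)
      + extd1 \<alpha>' p (JX p) (Y p) + extd1 \<alpha>' p (X p) (JY p)"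
    unfolding C(1)[OF d(1,2)] C(1)[OF d(3,4)] C(2)[OF d(3,2)] C(2)[OF d(1,4)] swap neg' by simp
  finally show ?thesis by (simp add: JX_def JY_def)
qed

section \<open>Curvature by moving frames\<close>

text \<open>An orthonormal coframe \<open>E\<close> of a metric \<open>g\<close>, its dual frame \<open>e\<close>, and a
  skew-symmetric matrix of connection forms \<open>\<omega>\<close> that solves Cartan's first structure
  equation.\<close>

locale moving_frame =
  fixes M :: "'a::euclidean_space set" and g :: "'a tensor2" and I :: "'i set"
    and E :: "'i \<Rightarrow> 'a form1" and e :: "'i \<Rightarrow> 'a vfield" and \<omega> :: "'i \<Rightarrow> 'i \<Rightarrow> 'a form1"
  assumes open_M: "open M" and finite_I: "finite I"
    and smooth_E: "i \<in> I \<Longrightarrow> smooth_form1 M (E i)"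
    and smooth_e: "i \<in> I \<Longrightarrow> smooth_on M (e i)"
    and smooth_\<omega>: "i \<in> I \<Longrightarrow> j \<in> I \<Longrightarrow> smooth_form1 M (\<omega> i j)"
    and metric: "p \<in> M \<Longrightarrow> g p v w = (\<Sum>i\<in>I. E i p v * E i p w)"
    and dual: "p \<in> M \<Longrightarrow> i \<in> I \<Longrightarrow> j \<in> I \<Longrightarrow> E i p (e j p) = (if i = j then 1 else 0)"
    and expand: "p \<in> M \<Longrightarrow> (\<Sum>i\<in>I. E i p v *\<^sub>R e i p) = v"
    and skew: "p \<in> M \<Longrightarrow> i \<in> I \<Longrightarrow> j \<in> I \<Longrightarrow> \<omega> i j p v = - \<omega> j i p v"
    and structure_eq: "p \<in> M \<Longrightarrow> i \<in> I \<Longrightarrow>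
      extd1 (E i) p u v = - (\<Sum>j\<in>I. wedge11 (\<omega> i j p) (E j p) u v)"
begin

definition curvature_form :: "'i \<Rightarrow> 'i \<Rightarrow> 'a tensor2" where
  "curvature_form i j p u v =
     extd1 (\<omega> i j) p u v + (\<Sum>k\<in>I. wedge11 (\<omega> i k p) (\<omega> k j p) u v)"

text \<open>In frame components the covariant derivative is the componentwise derivative plus the action
  of the connection matrix; on constant vector fields this is the Christoffel symbol.\<close>

definition frame_christoffel :: "'a \<Rightarrow> 'a \<Rightarrow> 'a \<Rightarrow> 'a" where
  "frame_christoffel p u v =
     (\<Sum>i\<in>I. (dderiv (\<lambda>q. E i q v) p u + (\<Sum>j\<in>I. \<omega> i j p u * E j p v)) *\<^sub>R e i p)"

lemma linear_E: "p \<in> M \<Longrightarrow> i \<in> I \<Longrightarrow> linear (E i p)"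
  using smooth_E by (simp add: smooth_form1_def)

lemma diff_E: "p \<in> M \<Longrightarrow> i \<in> I \<Longrightarrow> (\<lambda>q. E i q v) differentiable (at p)"
  by (rule smooth_form1_differentiable[OF smooth_E])

lemma linear_\<omega>: "p \<in> M \<Longrightarrow> i \<in> I \<Longrightarrow> j \<in> I \<Longrightarrow> linear (\<omega> i j p)"
  using smooth_\<omega> by (simp add: smooth_form1_def)

lemma diff_\<omega>: "p \<in> M \<Longrightarrow> i \<in> I \<Longrightarrow> j \<in> I \<Longrightarrow> (\<lambda>q. \<omega> i j q v) differentiable (at p)"
  by (rule smooth_form1_differentiable[OF smooth_\<omega>])

lemma E_frame_sum:
  assumes "p \<in> M" "i \<in> I"
  shows "E i p (\<Sum>j\<in>I. c j *\<^sub>R e j p) = c i"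
proof -
  have "E i p (\<Sum>j\<in>I. c j *\<^sub>R e j p) = (\<Sum>j\<in>I. c j * E i p (e j p))"
    using linear_E[OF assms] by (simp add: linear_sum linear_cmul)
  also have "\<dots> = (\<Sum>j\<in>I. if i = j then c j else 0)"
    by (rule sum.cong) (auto simp: dual assms)
  finally show ?thesis using assms(2) finite_I by (simp add: sum.delta')
qed

lemma E_frame_christoffel:
  assumes "p \<in> M" "i \<in> I"
  shows "E i p (frame_christoffel p u v) =
    dderiv (\<lambda>q. E i q v) p u + (\<Sum>j\<in>I. \<omega> i j p u * E j p v)"
  unfolding frame_christoffel_def by (rule E_frame_sum[OF assms])

lemma eq_if_E_eq:
  assumes "p \<in> M" "\<And>i. i \<in> I \<Longrightarrow> E i p v = E i p w"
  shows "v = w"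
proof -
  have "v = (\<Sum>i\<in>I. E i p v *\<^sub>R e i p)" by (rule expand[OF assms(1), symmetric])
  also have "\<dots> = (\<Sum>i\<in>I. E i p w *\<^sub>R e i p)" by (rule sum.cong) (simp_all add: assms(2))
  also have "\<dots> = w" by (rule expand[OF assms(1)])
  finally show ?thesis .
qed

text \<open>In the Koszul formula the derivatives of the coframe enter through exterior derivatives,
  and the first structure equation replaces these by the connection forms. The double sums that
  arise are skew in their last two arguments, and all but two of them cancel.\<close>

lemma koszul_frame_christoffel:
  assumes p: "p \<in> M"
  shows "2 * g p (frame_christoffel p u v) k =
    dderiv (\<lambda>q. g q v k) p u + dderiv (\<lambda>q. g q u k) p v - dderiv (\<lambda>q. g q u v) p k"
proof -
  define A where "A i x y = dderiv (\<lambda>q. E i q y) p x" for i x y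
  define S where "S x y z = (\<Sum>i\<in>I. \<Sum>j\<in>I. \<omega> i j p x * E i p y * E j p z)" for x y z
  have S_skew: "S x y z = - S x z y" for x y z
  proof -
    have "S x y z = (\<Sum>j\<in>I. \<Sum>i\<in>I. \<omega> i j p x * E i p y * E j p z)"
      unfolding S_def by (rule sum.swap)
    also have "\<dots> = (\<Sum>j\<in>I. \<Sum>i\<in>I. - (\<omega> j i p x * E j p z * E i p y))"
    proof (intro sum.cong refl)
      fix j i assume "j \<in> I" "i \<in> I"
      then show "\<omega> i j p x * E i p y * E j p z = - (\<omega> j i p x * E j p z * E i p y)"
        using skew[OF p, of i j x] by simp
    qed
    finally show ?thesis by (simp add: S_def sum_negf)
  qed
  have Dg: "dderiv (\<lambda>q. g q y z) p x = (\<Sum>i\<in>I. A i x y * E i p z + E i p y * A i x z)" for x y z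
  proof -
    have "((\<lambda>q. \<Sum>i\<in>I. E i q y * E i q z) has_derivative
        (\<lambda>x. \<Sum>i\<in>I. E i p y * A i x z + A i x y * E i p z)) (at p)"
      unfolding A_def by (intro has_derivative_sum has_derivative_mult has_derivative_dderiv diff_E p)
    from dderiv_eq[OF this] dderiv_cong_open[OF open_M p metric]
    show ?thesis by (simp add: add.commute)
  qed
  have dE: "A i x y - A i y x = - (\<Sum>j\<in>I. \<omega> i j p x * E j p y - \<omega> i j p y * E j p x)"
    if "i \<in> I" for i x y
    using structure_eq[OF p that, of x y] by (simp add: extd1_def A_def wedge11_def)
  have wedge_S: "(\<Sum>i\<in>I. E i p z * (A i x y - A i y x)) = - S x z y + S y z x" for x y z
  proof -
    have "(\<Sum>i\<in>I. E i p z * (A i x y - A i y x)) =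
        (\<Sum>i\<in>I. \<Sum>j\<in>I. - (\<omega> i j p x * E i p z * E j p y) + \<omega> i j p y * E i p z * E j p x)"
      by (rule sum.cong) (auto simp: dE sum_distrib_left sum_negf[symmetric] algebra_simps intro!: sum.cong)
    then show ?thesis by (simp add: S_def sum.distrib sum_negf sum_subtractf)
  qed
  have "dderiv (\<lambda>q. g q v k) p u + dderiv (\<lambda>q. g q u k) p v - dderiv (\<lambda>q. g q u v) p k =
      2 * (\<Sum>i\<in>I. A i u v * E i p k) - (\<Sum>i\<in>I. E i p k * (A i u v - A i v u))
      + (\<Sum>i\<in>I. E i p v * (A i u k - A i k u)) + (\<Sum>i\<in>I. E i p u * (A i v k - A i k v))"
    unfolding Dg sum_distrib_left sum.distrib[symmetric] sum_subtractf[symmetric]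
    by (rule sum.cong) (auto simp: algebra_simps)
  also have "\<dots> = 2 * (\<Sum>i\<in>I. A i u v * E i p k) + 2 * S u k v"
    unfolding wedge_S using S_skew[of u v k] S_skew[of v u k] S_skew[of k u v] by simp
  also have "\<dots> = 2 * (\<Sum>i\<in>I. E i p (frame_christoffel p u v) * E i p k)"
    by (simp add: E_frame_christoffel[OF p] A_def S_def distrib_left sum.distrib sum_distrib_left
        mult_ac cong: sum.cong)
  finally show ?thesis by (simp add: metric[OF p])
qed

text \<open>The Koszul formula determines the vector, since pairing with the frame gives all components.\<close>

lemma christoffel_eq:
  assumes p: "p \<in> M"
  shows "christoffel g p u v = frame_christoffel p u v"
  unfolding christoffel_def
proof (rule the_equality)
  show "\<forall>k. 2 * g p (frame_christoffel p u v) k =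
    dderiv (\<lambda>q. g q v k) p u + dderiv (\<lambda>q. g q u k) p v - dderiv (\<lambda>q. g q u v) p k"
    using koszul_frame_christoffel[OF p] by blast
next
  fix w
  assume w: "\<forall>k. 2 * g p w k =
    dderiv (\<lambda>q. g q v k) p u + dderiv (\<lambda>q. g q u k) p v - dderiv (\<lambda>q. g q u v) p k"
  have "2 * g p w k = 2 * g p (frame_christoffel p u v) k" for k
    unfolding koszul_frame_christoffel[OF p] by (rule spec[OF w])
  then have eq: "g p w k = g p (frame_christoffel p u v) k" for k
    by simp
  have "g p x (e i p) = E i p x" if "i \<in> I" for i x
  proof -
    have "g p x (e i p) = (\<Sum>j\<in>I. if j = i then E j p x else 0)"
      unfolding metric[OF p] by (rule sum.cong) (auto simp: dual p that)
    then show ?thesis using that finite_I by (simp add: sum.delta)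
  qed
  then show "w = frame_christoffel p u v"
    using eq eq_if_E_eq[OF p] by metis
qed

lemma E_levi_civita:
  assumes p: "p \<in> M" and i: "i \<in> I" and Z: "Z differentiable (at p)"
  shows "E i p (levi_civita g X Z p) =
    dderiv (\<lambda>q. E i q (Z q)) p (X p) + (\<Sum>j\<in>I. \<omega> i j p (X p) * E j p (Z p))"
  using dderiv_eq[OF has_derivative_apply[OF open_M p linear_E[OF _ i] diff_E[OF p i] Z]]
  by (simp add: levi_civita_def linear_add[OF linear_E[OF p i]] christoffel_eq[OF p]
      E_frame_christoffel[OF p i])

lemma differentiable_frame_christoffel:
  assumes p: "p \<in> M"
  shows "(\<lambda>q. frame_christoffel q u v) differentiable (at p)"
proof -
  have 1: "(\<lambda>q. dderiv (\<lambda>q. E i q v) q u) differentiable (at p)" "e i differentiable (at p)"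
    if "i \<in> I" for i
    using smooth_E[OF that] smooth_e[OF that] p
    by (auto simp: smooth_form1_def intro: smooth_on_imp_differentiable smooth_on_dderiv)
  show ?thesis
    unfolding frame_christoffel_def
    by (intro differentiable_sum ballI differentiable_scaleR differentiable_add differentiable_mult
        diff_E diff_\<omega> 1 p finite_I)
qed

text \<open>Cartan's second structure equation. Second derivatives of the coframe drop out because
  they are symmetric, and first derivatives cancel against the connection matrix.\<close>

lemma E_curvature:
  assumes p: "p \<in> M" and i: "i \<in> I"
  shows "E i p (curvature g (\<lambda>_. u) (\<lambda>_. v) (\<lambda>_. w) p) =
    (\<Sum>j\<in>I. curvature_form i j p u v * E j p w)"
proof -
  have const: "dderiv (\<lambda>_. c) q x = 0" for c x q :: 'a
    by (rule dderiv_eq) simp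
  have LC: "levi_civita g (\<lambda>_. x) (\<lambda>_. y) q = frame_christoffel q x y" if "q \<in> M" for q x y
    using that by (simp add: levi_civita_def const christoffel_eq)
  have LC_diff: "levi_civita g (\<lambda>_. x) (\<lambda>_. y) differentiable (at p)" for x y
    using differentiable_cong_open[OF differentiable_frame_christoffel[OF p] open_M p] LC by metis
  define A where "A j x y = dderiv (\<lambda>q. E j q y) p x" for j x y
  have zero: "E i p (levi_civita g (lie_bracket (\<lambda>_. u) (\<lambda>_. v)) (\<lambda>_. w) p) = 0"
  proof -
    have "linear (dderiv (\<lambda>q. E i q w) p)"
      by (rule linear_dderiv[OF diff_E[OF p i]])
    then show ?thesis
      using linear_0[OF linear_\<omega>[OF p i]]
      by (subst E_levi_civita[OF p i]) (simp_all add: lie_bracket_def const linear_0 cong: sum.cong)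
  qed
  have second: "E i p (levi_civita g (\<lambda>_. x) (levi_civita g (\<lambda>_. y) (\<lambda>_. w)) p) =
      dderiv (\<lambda>q. dderiv (\<lambda>q. E i q w) q y) p x
      + (\<Sum>j\<in>I. dderiv (\<lambda>q. \<omega> i j q y) p x * E j p w + \<omega> i j p y * A j x w + \<omega> i j p x * A j y w
          + \<omega> i j p x * (\<Sum>k\<in>I. \<omega> j k p y * E k p w))" for x y
  proof -
    have d2: "(\<lambda>q. dderiv (\<lambda>q. E i q w) q y) differentiable (at p)"
      using smooth_E[OF i] p
      by (auto simp: smooth_form1_def intro: smooth_on_imp_differentiable smooth_on_dderiv)
    have "((\<lambda>q. dderiv (\<lambda>q. E i q w) q y + (\<Sum>j\<in>I. \<omega> i j q y * E j q w)) has_derivative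
        (\<lambda>x. dderiv (\<lambda>q. dderiv (\<lambda>q. E i q w) q y) p x
          + (\<Sum>j\<in>I. \<omega> i j p y * A j x w + dderiv (\<lambda>q. \<omega> i j q y) p x * E j p w))) (at p)"
      unfolding A_def
      by (intro has_derivative_add has_derivative_sum has_derivative_mult has_derivative_dderiv
          d2 diff_E diff_\<omega> p i)
    from dderiv_eq[OF this]
    have 1: "dderiv (\<lambda>q. E i q (levi_civita g (\<lambda>_. y) (\<lambda>_. w) q)) p x =
        dderiv (\<lambda>q. dderiv (\<lambda>q. E i q w) q y) p x
          + (\<Sum>j\<in>I. \<omega> i j p y * A j x w + dderiv (\<lambda>q. \<omega> i j q y) p x * E j p w)"
      using dderiv_cong_open[OF open_M p, of "\<lambda>q. E i q (levi_civita g (\<lambda>_. y) (\<lambda>_. w) q)"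
          "\<lambda>q. dderiv (\<lambda>q. E i q w) q y + (\<Sum>j\<in>I. \<omega> i j q y * E j q w)"]
      by (simp add: LC E_frame_christoffel i)
    have 2: "(\<Sum>j\<in>I. \<omega> i j p x * E j p (levi_civita g (\<lambda>_. y) (\<lambda>_. w) p)) =
        (\<Sum>j\<in>I. \<omega> i j p x * A j y w + \<omega> i j p x * (\<Sum>k\<in>I. \<omega> j k p y * E k p w))"
      by (rule sum.cong) (simp_all add: LC p E_frame_christoffel A_def distrib_left)
    show ?thesis
      unfolding E_levi_civita[OF p i LC_diff] 1 2 by (simp add: sum.distrib algebra_simps)
  qed
  have sym: "dderiv (\<lambda>q. dderiv (\<lambda>q. E i q w) q v) p u = dderiv (\<lambda>q. dderiv (\<lambda>q. E i q w) q u) p v"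
    using smooth_E[OF i]
    by (intro dderiv_dderiv_commute[OF open_M p]) (auto simp: smooth_form1_def smooth_on_def)
  have swap: "(\<Sum>j\<in>I. \<omega> i j p x * (\<Sum>k\<in>I. \<omega> j k p y * E k p w)) =
      (\<Sum>k\<in>I. (\<Sum>j\<in>I. \<omega> i j p x * \<omega> j k p y) * E k p w)" for x y
    unfolding sum_distrib_left sum_distrib_right
    by (subst sum.swap) (simp add: mult.assoc)
  have "E i p (curvature g (\<lambda>_. u) (\<lambda>_. v) (\<lambda>_. w) p) =
      (\<Sum>j\<in>I. extd1 (\<omega> i j) p u v * E j p w)
      + (\<Sum>j\<in>I. \<omega> i j p u * (\<Sum>k\<in>I. \<omega> j k p v * E k p w))
      - (\<Sum>j\<in>I. \<omega> i j p v * (\<Sum>k\<in>I. \<omega> j k p u * E k p w))"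
    unfolding curvature_def linear_diff[OF linear_E[OF p i]] second zero sym
    by (simp add: extd1_def sum.distrib sum_subtractf left_diff_distrib)
  also have "\<dots> = (\<Sum>j\<in>I. curvature_form i j p u v * E j p w)"
    unfolding swap
    by (simp add: curvature_form_def wedge11_def sum.distrib sum_subtractf distrib_right
        left_diff_distrib mult.commute[of "\<omega> _ _ p v"] cong: sum.cong)
  finally show ?thesis .
qed

text \<open>The trace over the standard basis equals the trace over the frame, since each frame
  component of the curvature is linear in its first argument.\<close>

lemma ricci_eq:
  assumes p: "p \<in> M"
  shows "ricci g p v w = (\<Sum>i\<in>I. \<Sum>j\<in>I. curvature_form i j p (e i p) v * E j p w)"
proof -
  define L where "L i u = (\<Sum>j\<in>I. curvature_form i j p u v * E j p w)" for i u
  have lin_extd1: "linear (\<lambda>u. extd1 (\<omega> i j) p u v)" if "i \<in> I" "j \<in> I" for i j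
  proof -
    have a: "linear (\<lambda>u. dderiv (\<lambda>q. \<omega> i j q u) p v)"
    proof (rule linearI)
      fix x y
      have "dderiv (\<lambda>q. \<omega> i j q (x + y)) p v = dderiv (\<lambda>q. \<omega> i j q x + \<omega> i j q y) p v"
        by (rule dderiv_cong_open[OF open_M p]) (simp add: linear_add[OF linear_\<omega>] that)
      also have "\<dots> = dderiv (\<lambda>q. \<omega> i j q x) p v + dderiv (\<lambda>q. \<omega> i j q y) p v"
        by (rule dderiv_eq) (intro has_derivative_add has_derivative_dderiv diff_\<omega> p that)
      finally show "dderiv (\<lambda>q. \<omega> i j q (x + y)) p v =
          dderiv (\<lambda>q. \<omega> i j q x) p v + dderiv (\<lambda>q. \<omega> i j q y) p v" .
    next
      fix r x
      have "dderiv (\<lambda>q. \<omega> i j q (r *\<^sub>R x)) p v = dderiv (\<lambda>q. r * \<omega> i j q x) p v"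
        by (rule dderiv_cong_open[OF open_M p]) (simp add: linear_cmul[OF linear_\<omega>] that)
      also have "\<dots> = r * dderiv (\<lambda>q. \<omega> i j q x) p v"
        by (rule dderiv_eq) (intro has_derivative_mult_right has_derivative_dderiv diff_\<omega> p that)
      finally show "dderiv (\<lambda>q. \<omega> i j q (r *\<^sub>R x)) p v = r *\<^sub>R dderiv (\<lambda>q. \<omega> i j q x) p v"
        by simp
    qed
    show ?thesis
      unfolding extd1_def
      by (intro linear_compose_sub linear_dderiv diff_\<omega> p that a)
  qed
  have lin_mult: "linear (\<lambda>u. f u * c)" if "linear f" for f :: "'a \<Rightarrow> real" and c
    by (rule linearI) (simp_all add: linear_add[OF that] linear_cmul[OF that] algebra_simps)
  have "linear (L i)" if "i \<in> I" for i
    unfolding L_def curvature_form_def wedge11_def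
    using that
    by (intro linear_compose_sum ballI lin_mult linear_compose_add linear_compose_sub lin_extd1 linear_\<omega> p)
      (auto simp: mult.commute[of "\<omega> _ _ p v"] intro!: lin_mult linear_\<omega> p)
  then have LB: "L i (e i p) = (\<Sum>b\<in>Basis. (e i p \<bullet> b) * L i b)" if "i \<in> I" for i
    using linear_expand_Basis[of "L i" "e i p"] that by simp
  have R: "curvature g (\<lambda>_. b) (\<lambda>_. v) (\<lambda>_. w) p = (\<Sum>i\<in>I. L i b *\<^sub>R e i p)" for b
    using expand[OF p, of "curvature g (\<lambda>_. b) (\<lambda>_. v) (\<lambda>_. w) p"]
    by (simp add: E_curvature[OF p] L_def cong: sum.cong)
  have "ricci g p v w = (\<Sum>b\<in>Basis. \<Sum>i\<in>I. (e i p \<bullet> b) * L i b)"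
    unfolding ricci_def R by (simp add: inner_sum_left mult.commute)
  also have "\<dots> = (\<Sum>i\<in>I. \<Sum>b\<in>Basis. (e i p \<bullet> b) * L i b)"
    by (rule sum.swap)
  also have "\<dots> = (\<Sum>i\<in>I. L i (e i p))"
    by (rule sum.cong) (simp_all add: LB)
  finally show ?thesis by (simp add: L_def)
qed

lemma curvature_form_skew:
  assumes p: "p \<in> M" and "i \<in> I" "j \<in> I"
  shows "curvature_form i j p u v = - curvature_form j i p u v"
proof -
  have "extd1 (\<omega> i j) p u v = extd1 (\<lambda>q v. - \<omega> j i q v) p u v"
    by (rule extd1_cong_open[OF open_M p]) (rule skew[OF _ assms(2,3)])
  also have "\<dots> = - extd1 (\<omega> j i) p u v"
    by (rule extd1_minus[OF p smooth_\<omega> smooth_\<omega>]) (rule assms)+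
  finally have "extd1 (\<omega> i j) p u v = - extd1 (\<omega> j i) p u v" .
  moreover have "(\<Sum>k\<in>I. wedge11 (\<omega> i k p) (\<omega> k j p) u v) =
      (\<Sum>k\<in>I. - wedge11 (\<omega> j k p) (\<omega> k i p) u v)"
  proof (rule sum.cong)
    fix k assume "k \<in> I"
    then have "\<omega> i k p x = - \<omega> k i p x" "\<omega> k j p x = - \<omega> j k p x" for x
      using skew[OF p] assms by blast+
    then show "wedge11 (\<omega> i k p) (\<omega> k j p) u v = - wedge11 (\<omega> j k p) (\<omega> k i p) u v"
      by (simp add: wedge11_def)
  qed simp
  ultimately show ?thesis by (simp add: curvature_form_def sum_negf)
qed

end

section \<open>The coframe and its connection forms\<close>

text \<open>Rotating \<open>dx\<close> and \<open>dy\<close> by the angle \<open>t\<close> removes all explicit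
  \<open>t\<close>-dependence from the structure equations.\<close>

definition rot1 :: "space4 form1" where
  "rot1 p v = cos (tcoord p) * dx v - sin (tcoord p) * dy v"

definition rot2 :: "space4 form1" where
  "rot2 p v = sin (tcoord p) * dx v + cos (tcoord p) * dy v"

text \<open>This is the connection form of the surface metric \<open>F\<^sup>2 (dx\<^sup>2 + dy\<^sup>2)\<close> in the coframe
  \<open>F rot1, F rot2\<close>. It is used for \<open>F = H\<close>, where it is the form \<open>\<beta>\<close> above, and for \<open>F = h\<close>.\<close>

definition surface_connection :: "(plane \<Rightarrow> real) \<Rightarrow> space4 form1" where
  "surface_connection F p v = dt v - l2 F (fst p) * dx v - n2 F (fst p) * dy v"

definition scaled :: "(plane \<Rightarrow> real) \<Rightarrow> space4 form1 \<Rightarrow> space4 form1" where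
  "scaled F \<alpha> p v = F (fst p) * \<alpha> p v"

lemma theta3_eq: "theta3 H p v =
    sin (zcoord p) * surface_connection H p v - cos (zcoord p) * scaled H rot1 p v"
  by (simp add: theta3_def surface_connection_def scaled_def rot1_def algebra_simps)

lemma theta4_eq: "theta4 H p v = dz v - scaled H rot2 p v"
  by (simp add: theta4_def scaled_def rot2_def algebra_simps)

lemma wedge11_rot: "wedge11 (rot1 p) (rot2 p) u v = dx u * dy v - dx v * dy u"
proof -
  have "wedge11 (rot1 p) (rot2 p) u v =
      ((sin (tcoord p))\<^sup>2 + (cos (tcoord p))\<^sup>2) * (dx u * dy v - dx v * dy u)"
    unfolding wedge11_def rot1_def rot2_def by algebra
  then show ?thesis by simp
qed

lemma extd1_rot:
  "extd1 rot1 p u v = - wedge11 dt (rot2 p) u v"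
  "extd1 rot2 p u v = wedge11 dt (rot1 p) u v"
proof -
  have 1: "dderiv (\<lambda>q. rot1 q v) p u = - dt u * rot2 p v" for u v
    unfolding rot1_def rot2_def
    by (rule dderiv_eq) (auto intro!: derivative_eq_intros simp: algebra_simps)
  have 2: "dderiv (\<lambda>q. rot2 q v) p u = dt u * rot1 p v" for u v
    unfolding rot1_def rot2_def
    by (rule dderiv_eq) (auto intro!: derivative_eq_intros simp: algebra_simps)
  show "extd1 rot1 p u v = - wedge11 dt (rot2 p) u v" "extd1 rot2 p u v = wedge11 dt (rot1 p) u v"
    by (simp_all add: extd1_def wedge11_def 1 2)
qed

lemma linear_coordinates: "linear dx" "linear dy" "linear dz" "linear dt"
  by (auto intro!: linearI)

lemma linear_rot: "linear (rot1 p)" "linear (rot2 p)"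
  by (auto intro!: linearI simp: rot1_def rot2_def algebra_simps)

lemma has_derivative_base:
  assumes "F differentiable (at (fst p))"
  shows "((\<lambda>q::space4. F (fst q)) has_derivative
    (\<lambda>u. partial_x F (fst p) * dx u + partial_y F (fst p) * dy u)) (at p)"
proof -
  note D = has_derivative_dderiv[OF assms]
  have "((\<lambda>q::space4. F (fst q)) has_derivative (\<lambda>u. dderiv F (fst p) (fst u))) (at p)"
    by (rule has_derivative_compose[of fst fst p UNIV F, OF _ D]) (auto intro!: derivative_eq_intros)
  moreover have "dderiv F (fst p) w = partial_x F (fst p) * fst w + partial_y F (fst p) * snd w" for w
  proof -
    have L: "linear (dderiv F (fst p))" by (rule linear_dderiv[OF assms])
    have "w = fst w *\<^sub>R (1, 0) + snd w *\<^sub>R (0, 1)" by (cases w) simp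
    then have "dderiv F (fst p) w =
        fst w *\<^sub>R dderiv F (fst p) (1, 0) + snd w *\<^sub>R dderiv F (fst p) (0, 1)"
      by (metis linear_add[OF L] linear_cmul[OF L])
    then show ?thesis by (simp add: partial_x_def partial_y_def mult.commute)
  qed
  ultimately show ?thesis by simp
qed

locale base_function =
  fixes U :: "plane set" and F :: "plane \<Rightarrow> real"
  assumes open_U: "open U" and smooth_F: "smooth_on U F" and F_pos: "\<And>q. q \<in> U \<Longrightarrow> F q > 0"
begin

lemma smooth_ln_F: "smooth_on U (\<lambda>r. ln (F r))"
  by (intro smooth_on_ln open_U smooth_F F_pos)

lemma smooth_n2: "smooth_on U (n2 F)"
  using smooth_on_dderiv[OF smooth_ln_F, of "(1, 0)"] by (simp add: n2_def[abs_def] partial_x_def)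

lemma smooth_l2: "smooth_on U (l2 F)"
  using smooth_on_minus[OF open_U smooth_on_dderiv[OF smooth_ln_F, of "(0, 1)"]]
  by (simp add: l2_def[abs_def] partial_y_def)

lemma partial_F:
  assumes "q \<in> U"
  shows "partial_x F q = F q * n2 F q" "partial_y F q = - F q * l2 F q"
proof -
  have D: "(F has_derivative dderiv F q) (at q)"
    by (rule has_derivative_dderiv[OF smooth_on_imp_differentiable[OF smooth_F assms]])
  have "((\<lambda>r. ln (F r)) has_derivative (\<lambda>v. dderiv F q v / F q)) (at q)"
    using F_pos[OF assms] by (auto intro!: derivative_eq_intros D simp: field_simps)
  from dderiv_eq[OF this]
  show "partial_x F q = F q * n2 F q" "partial_y F q = - F q * l2 F q"
    using F_pos[OF assms] by (auto simp: n2_def l2_def partial_x_def partial_y_def)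
qed

text \<open>The factor \<open>- \<Delta> ln F / F\<^sup>2\<close> is the Gauss curvature of \<open>F\<^sup>2 (dx\<^sup>2 + dy\<^sup>2)\<close>.\<close>

lemma extd1_surface_connection:
  assumes "fst p \<in> U"
  shows "extd1 (surface_connection F) p u v =
    - laplacian (\<lambda>r. ln (F r)) (fst p) * wedge11 (rot1 p) (rot2 p) u v"
proof -
  have n2: "n2 F differentiable (at (fst p))" and l2: "l2 F differentiable (at (fst p))"
    using smooth_n2 smooth_l2 assms smooth_on_imp_differentiable by blast+
  have D: "dderiv (\<lambda>q. surface_connection F q v) p u =
      - (partial_x (l2 F) (fst p) * dx u + partial_y (l2 F) (fst p) * dy u) * dx v
      - (partial_x (n2 F) (fst p) * dx u + partial_y (n2 F) (fst p) * dy u) * dy v" for u v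
    unfolding surface_connection_def
    by (rule dderiv_eq)
      (auto intro!: derivative_eq_intros has_derivative_base[OF n2] has_derivative_base[OF l2]
        simp: algebra_simps)
  have y: "partial_y (l2 F) (fst p) = - partial_y (partial_y (\<lambda>r. ln (F r))) (fst p)"
  proof -
    have "(\<lambda>q. partial_y (\<lambda>r. ln (F r)) q) differentiable (at (fst p))"
      using smooth_on_imp_differentiable[OF smooth_on_dderiv[OF smooth_ln_F] assms]
      by (simp add: partial_y_def)
    from dderiv_eq[OF has_derivative_minus[OF has_derivative_dderiv[OF this]]]
    show ?thesis
      unfolding l2_def[abs_def] partial_y_def[of "partial_y _"]
        partial_y_def[of "\<lambda>q. - partial_y (\<lambda>r. ln (F r)) q"] .
  qed
  have x: "partial_x (n2 F) (fst p) = partial_x (partial_x (\<lambda>r. ln (F r))) (fst p)"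
    by (simp add: n2_def[abs_def])
  show ?thesis
    unfolding extd1_def D wedge11_rot laplacian_def x y by (simp add: algebra_simps)
qed

lemma diff_F: "fst p \<in> U \<Longrightarrow> (\<lambda>q::space4. F (fst q)) differentiable (at p)"
  using has_derivative_base[OF smooth_on_imp_differentiable[OF smooth_F]]
  unfolding differentiable_def by blast

text \<open>These are the first structure equations of \<open>F\<^sup>2 (dx\<^sup>2 + dy\<^sup>2)\<close>. The rotation by \<open>t\<close> supplies the
  term \<open>dt\<close> of the connection form, and the logarithmic derivatives of \<open>F\<close> supply the others.\<close>

lemma extd1_scaled_rot:
  assumes "fst p \<in> U"
  shows "extd1 (scaled F rot1) p u v = - wedge11 (surface_connection F p) (scaled F rot2 p) u v"
    and "extd1 (scaled F rot2) p u v = wedge11 (surface_connection F p) (scaled F rot1 p) u v"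
proof -
  have dF: "dderiv (\<lambda>q::space4. F (fst q)) p u = F (fst p) * (n2 F (fst p) * dx u - l2 F (fst p) * dy u)" for u
    using dderiv_eq[OF has_derivative_base[OF smooth_on_imp_differentiable[OF smooth_F assms]]]
    by (simp add: partial_F[OF assms] algebra_simps)
  have d: "(\<lambda>q. rot1 q v) differentiable (at p)" "(\<lambda>q. rot2 q v) differentiable (at p)" for v
    unfolding rot1_def rot2_def differentiable_def
    by (rule exI, auto intro!: derivative_eq_intros)+
  have s: "scaled F \<alpha> = (\<lambda>q v. F (fst q) * \<alpha> q v)" for \<alpha>
    by (intro ext) (simp add: scaled_def)
  show "extd1 (scaled F rot1) p u v = - wedge11 (surface_connection F p) (scaled F rot2 p) u v"
    "extd1 (scaled F rot2) p u v = wedge11 (surface_connection F p) (scaled F rot1 p) u v"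
    unfolding s extd1_scale[OF diff_F[OF assms] d(1)] extd1_scale[OF diff_F[OF assms] d(2)] extd1_rot
    unfolding wedge11_def dF surface_connection_def rot1_def rot2_def
    by (algebra, algebra)
qed

end

datatype index = F1 | F2 | F3 | F4

lemma UNIV_index: "UNIV = {F1, F2, F3, F4}"
  using index.exhaust by auto

lemma sum_index: "(\<Sum>i\<in>UNIV. f i) = f F1 + f F2 + f F3 + f F4"
  for f :: "index \<Rightarrow> 'a::comm_monoid_add"
  by (simp add: UNIV_index add.assoc)

primrec coframe :: "(plane \<Rightarrow> real) \<Rightarrow> (plane \<Rightarrow> real) \<Rightarrow> index \<Rightarrow> space4 form1" where
  "coframe h H F1 = (\<lambda>p v. cos (zcoord p / 2) * scaled h rot1 p v)"
| "coframe h H F2 = (\<lambda>p v. cos (zcoord p / 2) * scaled h rot2 p v)"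
| "coframe h H F3 = theta3 H"
| "coframe h H F4 = theta4 H"

text \<open>The dual frame. The \<open>dz\<close>- and \<open>dt\<close>-components of the first two vectors are those that make
  \<open>\<theta>\<^sub>3\<close> and \<open>\<theta>\<^sub>4\<close> vanish.\<close>

primrec frame :: "(plane \<Rightarrow> real) \<Rightarrow> (plane \<Rightarrow> real) \<Rightarrow> index \<Rightarrow> space4 vfield" where
  "frame h H F1 = (\<lambda>p. (1 / (cos (zcoord p / 2) * h (fst p))) *\<^sub>R
     ((cos (tcoord p), - sin (tcoord p)),
      (0, cos (zcoord p) / sin (zcoord p) * H (fst p)
          + l2 H (fst p) * cos (tcoord p) - n2 H (fst p) * sin (tcoord p))))"
| "frame h H F2 = (\<lambda>p. (1 / (cos (zcoord p / 2) * h (fst p))) *\<^sub>R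
     ((sin (tcoord p), cos (tcoord p)),
      (H (fst p), l2 H (fst p) * sin (tcoord p) + n2 H (fst p) * cos (tcoord p))))"
| "frame h H F3 = (\<lambda>p. ((0, 0), (0, 1 / sin (zcoord p))))"
| "frame h H F4 = (\<lambda>p. ((0, 0), (1, 0)))"

text \<open>The entries above the diagonal of the connection matrix, which is the only skew solution of the
  first structure equation. They are written without denominators so that their exterior
  derivatives are easy to compute. The relations \<open>\<omega>\<^sub>1\<^sub>3 = - \<omega>\<^sub>2\<^sub>4\<close> and \<open>\<omega>\<^sub>1\<^sub>4 = \<omega>\<^sub>2\<^sub>3\<close> say that the complex
  structure with \<open>e\<^sub>1 \<mapsto> e\<^sub>2\<close> and \<open>e\<^sub>4 \<mapsto> e\<^sub>3\<close> is parallel: this is the Kaehler structure.\<close>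

fun upper_connection :: "(plane \<Rightarrow> real) \<Rightarrow> (plane \<Rightarrow> real) \<Rightarrow> index \<Rightarrow> index \<Rightarrow> space4 form1" where
  "upper_connection h H F1 F2 = (\<lambda>p v. surface_connection h p v
     + (sin (zcoord p / 2))\<^sup>2 * surface_connection H p v - sin (zcoord p) / 2 * scaled H rot1 p v)"
| "upper_connection h H F1 F3 = (\<lambda>p v. sin (zcoord p / 2) / 2 * scaled h rot2 p v)"
| "upper_connection h H F1 F4 = (\<lambda>p v. - sin (zcoord p / 2) / 2 * scaled h rot1 p v)"
| "upper_connection h H F2 F3 = (\<lambda>p v. - sin (zcoord p / 2) / 2 * scaled h rot1 p v)"
| "upper_connection h H F2 F4 = (\<lambda>p v. - sin (zcoord p / 2) / 2 * scaled h rot2 p v)"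
| "upper_connection h H F3 F4 = (\<lambda>p v.
     sin (zcoord p) * scaled H rot1 p v + cos (zcoord p) * surface_connection H p v)"
| "upper_connection h H _ _ = (\<lambda>p v. 0)"

definition connection :: "(plane \<Rightarrow> real) \<Rightarrow> (plane \<Rightarrow> real) \<Rightarrow> index \<Rightarrow> index \<Rightarrow> space4 form1" where
  "connection h H i j = (\<lambda>p v. upper_connection h H i j p v - upper_connection h H j i p v)"

locale twisted_metric =
  fixes U :: "plane set" and h H :: "plane \<Rightarrow> real"
  assumes open_U: "open U"
    and smooth_h: "smooth_on U h" and h_pos: "\<And>q. q \<in> U \<Longrightarrow> h q > 0"
    and smooth_H: "smooth_on U H" and H_pos: "\<And>q. q \<in> U \<Longrightarrow> H q > 0"
    and laplacian_ln_H: "\<And>q. q \<in> U \<Longrightarrow> laplacian (\<lambda>r. ln (H r)) q = (1/2) * (h q)\<^sup>2 - (H q)\<^sup>2"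
begin

sublocale h: base_function U h
  by unfold_locales (rule open_U smooth_h h_pos; assumption?)+

sublocale H: base_function U H
  by unfold_locales (rule open_U smooth_H H_pos; assumption?)+

definition M :: "space4 set" where "M = U \<times> {(z, t). 0 < z \<and> z < pi}"

lemma open_M: "open M"
proof -
  have "{(z, t). 0 < z \<and> z < pi} = {0<..<pi} \<times> (UNIV :: real set)" by auto
  then show ?thesis by (simp add: M_def open_Times open_U)
qed

lemma in_M:
  assumes "p \<in> M"
  shows "fst p \<in> U" "0 < zcoord p" "zcoord p < pi" "h (fst p) > 0" "H (fst p) > 0"
    "sin (zcoord p) > 0" "cos (zcoord p / 2) > 0" "sin (zcoord p / 2) > 0"
  using assms h_pos H_pos sin_gt_zero[of "zcoord p"] sin_gt_zero[of "zcoord p / 2"]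
  by (auto simp: M_def intro!: cos_gt_zero_pi)

lemma smooth_coords:
  "smooth_on M (\<lambda>p. zcoord p)" "smooth_on M (\<lambda>p. tcoord p)" "smooth_on M (\<lambda>p. fst p)"
  by (auto intro!: smooth_on_bounded_linear bounded_linear_fst_comp bounded_linear_snd_comp
      bounded_linear_fst bounded_linear_snd)

lemma smooth_base: "smooth_on U F \<Longrightarrow> smooth_on M (\<lambda>p. F (fst p))"
  by (rule smooth_on_compose[OF open_M open_U _ _ smooth_coords(3)]) (auto simp: M_def)

lemmas smooth_bases = smooth_base[OF smooth_h] smooth_base[OF smooth_H]
  smooth_base[OF h.smooth_l2] smooth_base[OF h.smooth_n2]
  smooth_base[OF H.smooth_l2] smooth_base[OF H.smooth_n2]

lemmas smooth_M = smooth_intros open_M smooth_coords smooth_bases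

section \<open>Structure equations\<close>

lemma smooth_rot: "smooth_form1 M rot1" "smooth_form1 M rot2"
  using linear_rot unfolding smooth_form1_def rot1_def rot2_def
  by (auto intro!: smooth_M)

lemma smooth_scaled_rot:
  "smooth_form1 M (scaled h rot1)" "smooth_form1 M (scaled h rot2)"
  "smooth_form1 M (scaled H rot1)" "smooth_form1 M (scaled H rot2)"
  using smooth_form1_scale[OF open_M smooth_bases(1) smooth_rot(1)]
    smooth_form1_scale[OF open_M smooth_bases(1) smooth_rot(2)]
    smooth_form1_scale[OF open_M smooth_bases(2) smooth_rot(1)]
    smooth_form1_scale[OF open_M smooth_bases(2) smooth_rot(2)]
  by (simp_all add: scaled_def[abs_def])

lemma smooth_surface_connection:
  "smooth_form1 M (surface_connection h)" "smooth_form1 M (surface_connection H)"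
  unfolding surface_connection_def[abs_def]
  by (intro smooth_form1_diff smooth_form1_scale smooth_form1_const linear_coordinates open_M smooth_bases)+

lemma smooth_dz: "smooth_form1 M (\<lambda>_. dz)"
  by (intro smooth_form1_const linear_coordinates)

lemmas smooth_forms = smooth_form1_add smooth_form1_diff smooth_form1_zero
  smooth_form1_scale[OF open_M] open_M smooth_scaled_rot smooth_surface_connection smooth_dz

lemma smooth_theta: "smooth_form1 M (theta3 H)" "smooth_form1 M (theta4 H)"
proof -
  have "theta3 H = (\<lambda>p v. sin (zcoord p) * surface_connection H p v - cos (zcoord p) * scaled H rot1 p v)"
    "theta4 H = (\<lambda>p v. dz v - scaled H rot2 p v)"
    by (intro ext theta3_eq theta4_eq)+
  then show "smooth_form1 M (theta3 H)" "smooth_form1 M (theta4 H)"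
    by (auto intro!: smooth_forms smooth_M)
qed

lemma smooth_coframe: "smooth_form1 M (coframe h H i)"
  by (cases i) (auto intro!: smooth_theta smooth_forms smooth_M)

lemma smooth_connection: "smooth_form1 M (connection h H i j)"
proof -
  have "smooth_form1 M (upper_connection h H i j)" for i j
    by (cases i; cases j; simp only: upper_connection.simps; intro smooth_forms smooth_M; simp)
  then show ?thesis
    unfolding connection_def by (intro smooth_forms)
qed

lemma smooth_frame: "smooth_on M (frame h H i)"
proof -
  have "cos (zcoord p / 2) * h (fst p) \<noteq> 0" "sin (zcoord p) \<noteq> 0" if "p \<in> M" for p
    using in_M[OF that] by auto
  then show ?thesis
    by (cases i) (auto intro!: smooth_M simp: in_M)
qed

lemma extd1_zscale:
  assumes "p \<in> M" "smooth_form1 M \<alpha>" "(f has_real_derivative f') (at (zcoord p))"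
  shows "extd1 (\<lambda>q v. f (zcoord q) * \<alpha> q v) p u v =
    f' * wedge11 dz (\<alpha> p) u v + f (zcoord p) * extd1 \<alpha> p u v"
proof -
  have "((\<lambda>q::space4. f (zcoord q)) has_derivative (\<lambda>u. f' * dz u)) (at p)"
    using has_derivative_compose[of "\<lambda>q::space4. zcoord q" "\<lambda>u. dz u" p UNIV f "(*) f'"] assms(3)
    by (simp add: has_field_derivative_def has_derivative_fst has_derivative_snd)
  then have "dderiv (\<lambda>q::space4. f (zcoord q)) p = (\<lambda>u. f' * dz u)"
      "(\<lambda>q::space4. f (zcoord q)) differentiable (at p)"
    using dderiv_eq by (blast, auto simp: differentiable_def)
  then show ?thesis
    by (simp only: extd1_scale smooth_form1_differentiable[OF assms(2,1)] wedge11_def)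
      (simp add: algebra_simps)
qed

lemma extd1_connection_h:
  "p \<in> M \<Longrightarrow> extd1 (surface_connection h) p u v =
    - laplacian (\<lambda>r. ln (h r)) (fst p) * wedge11 (rot1 p) (rot2 p) u v"
  using h.extd1_surface_connection in_M(1) by blast

text \<open>The differential equation for \<open>H\<close> says that \<open>H\<^sup>2 (dx\<^sup>2 + dy\<^sup>2)\<close> has Gauss curvature
  \<open>1 - h\<^sup>2 / (2 H\<^sup>2)\<close>; this is the form in which the proof uses it.\<close>

lemma extd1_connection_H:
  "p \<in> M \<Longrightarrow> extd1 (surface_connection H) p u v =
    ((H (fst p))\<^sup>2 - (h (fst p))\<^sup>2 / 2) * wedge11 (rot1 p) (rot2 p) u v"
  using H.extd1_surface_connection[OF in_M(1)] laplacian_ln_H[OF in_M(1)] by simp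

context
  fixes p assumes p: "p \<in> M"
begin

abbreviation (input) "s \<equiv> sin (zcoord p / 2)"
abbreviation (input) "c \<equiv> cos (zcoord p / 2)"

lemma half_angle: "sin (zcoord p) = 2 * s * c" "cos (zcoord p) = c\<^sup>2 - s\<^sup>2" "s\<^sup>2 + c\<^sup>2 = 1"
  using sin_double[of "zcoord p / 2"] cos_double[of "zcoord p / 2"] by simp_all

lemmas zscale = extd1_zscale[OF p]
lemmas d_scaled = h.extd1_scaled_rot[OF in_M(1)[OF p]] H.extd1_scaled_rot[OF in_M(1)[OF p]]

lemma zscale_rules:
  assumes "smooth_form1 M \<alpha>"
  shows "extd1 (\<lambda>q v. cos (zcoord q / 2) * \<alpha> q v) p u v =
      - (s / 2) * wedge11 dz (\<alpha> p) u v + c * extd1 \<alpha> p u v"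
    and "extd1 (\<lambda>q v. sin (zcoord q / 2) / 2 * \<alpha> q v) p u v =
      c / 4 * wedge11 dz (\<alpha> p) u v + s / 2 * extd1 \<alpha> p u v"
    and "extd1 (\<lambda>q v. - sin (zcoord q / 2) / 2 * \<alpha> q v) p u v =
      - (c / 4) * wedge11 dz (\<alpha> p) u v - s / 2 * extd1 \<alpha> p u v"
    and "extd1 (\<lambda>q v. (sin (zcoord q / 2))\<^sup>2 * \<alpha> q v) p u v =
      s * c * wedge11 dz (\<alpha> p) u v + s\<^sup>2 * extd1 \<alpha> p u v"
    and "extd1 (\<lambda>q v. sin (zcoord q) / 2 * \<alpha> q v) p u v =
      cos (zcoord p) / 2 * wedge11 dz (\<alpha> p) u v + sin (zcoord p) / 2 * extd1 \<alpha> p u v"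
    and "extd1 (\<lambda>q v. sin (zcoord q) * \<alpha> q v) p u v =
      cos (zcoord p) * wedge11 dz (\<alpha> p) u v + sin (zcoord p) * extd1 \<alpha> p u v"
    and "extd1 (\<lambda>q v. cos (zcoord q) * \<alpha> q v) p u v =
      - sin (zcoord p) * wedge11 dz (\<alpha> p) u v + cos (zcoord p) * extd1 \<alpha> p u v"
proof -
  let ?D = "\<lambda>f f'. (f has_real_derivative f') (at (zcoord p))"
  have D: "?D (\<lambda>z. cos (z / 2)) (- (s / 2))" "?D (\<lambda>z. sin (z / 2) / 2) (c / 4)"
    "?D (\<lambda>z. - sin (z / 2) / 2) (- (c / 4))" "?D (\<lambda>z. (sin (z / 2))\<^sup>2) (s * c)"
    "?D (\<lambda>z. sin z / 2) (cos (zcoord p) / 2)" "?D sin (cos (zcoord p))" "?D cos (- sin (zcoord p))"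
    by (auto intro!: derivative_eq_intros)
  note Z = D[THEN zscale[OF assms], of u v]
  show "extd1 (\<lambda>q v. cos (zcoord q / 2) * \<alpha> q v) p u v =
      - (s / 2) * wedge11 dz (\<alpha> p) u v + c * extd1 \<alpha> p u v"
    "extd1 (\<lambda>q v. sin (zcoord q / 2) / 2 * \<alpha> q v) p u v =
      c / 4 * wedge11 dz (\<alpha> p) u v + s / 2 * extd1 \<alpha> p u v"
    "extd1 (\<lambda>q v. - sin (zcoord q / 2) / 2 * \<alpha> q v) p u v =
      - (c / 4) * wedge11 dz (\<alpha> p) u v - s / 2 * extd1 \<alpha> p u v"
    "extd1 (\<lambda>q v. (sin (zcoord q / 2))\<^sup>2 * \<alpha> q v) p u v =
      s * c * wedge11 dz (\<alpha> p) u v + s\<^sup>2 * extd1 \<alpha> p u v"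
    "extd1 (\<lambda>q v. sin (zcoord q) / 2 * \<alpha> q v) p u v =
      cos (zcoord p) / 2 * wedge11 dz (\<alpha> p) u v + sin (zcoord p) / 2 * extd1 \<alpha> p u v"
    "extd1 (\<lambda>q v. sin (zcoord q) * \<alpha> q v) p u v =
      cos (zcoord p) * wedge11 dz (\<alpha> p) u v + sin (zcoord p) * extd1 \<alpha> p u v"
    "extd1 (\<lambda>q v. cos (zcoord q) * \<alpha> q v) p u v =
      - sin (zcoord p) * wedge11 dz (\<alpha> p) u v + cos (zcoord p) * extd1 \<alpha> p u v"
    using Z by simp_all
qed

lemma extd1_coframe:
  "extd1 (coframe h H F1) p u v =
     - (s / 2) * wedge11 dz (scaled h rot1 p) u v
     - c * wedge11 (surface_connection h p) (scaled h rot2 p) u v"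
  "extd1 (coframe h H F2) p u v =
     - (s / 2) * wedge11 dz (scaled h rot2 p) u v
     + c * wedge11 (surface_connection h p) (scaled h rot1 p) u v"
  "extd1 (coframe h H F3) p u v =
     cos (zcoord p) * wedge11 dz (surface_connection H p) u v
     + sin (zcoord p) * ((H (fst p))\<^sup>2 - (h (fst p))\<^sup>2 / 2) * wedge11 (rot1 p) (rot2 p) u v
     + sin (zcoord p) * wedge11 dz (scaled H rot1 p) u v
     + cos (zcoord p) * wedge11 (surface_connection H p) (scaled H rot2 p) u v"
  "extd1 (coframe h H F4) p u v = - wedge11 (surface_connection H p) (scaled H rot1 p) u v"
proof -
  show "extd1 (coframe h H F1) p u v =
     - (s / 2) * wedge11 dz (scaled h rot1 p) u v
     - c * wedge11 (surface_connection h p) (scaled h rot2 p) u v"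
    "extd1 (coframe h H F2) p u v =
     - (s / 2) * wedge11 dz (scaled h rot2 p) u v
     + c * wedge11 (surface_connection h p) (scaled h rot1 p) u v"
    by (simp_all add: zscale_rules smooth_forms d_scaled)
  have 3: "coframe h H F3 = (\<lambda>q v. sin (zcoord q) * surface_connection H q v
      - cos (zcoord q) * scaled H rot1 q v)"
    by (simp, intro ext theta3_eq)
  have 4: "coframe h H F4 = (\<lambda>q v. dz v - scaled H rot2 q v)"
    by (simp, intro ext theta4_eq)
  show "extd1 (coframe h H F3) p u v =
     cos (zcoord p) * wedge11 dz (surface_connection H p) u v
     + sin (zcoord p) * ((H (fst p))\<^sup>2 - (h (fst p))\<^sup>2 / 2) * wedge11 (rot1 p) (rot2 p) u v
     + sin (zcoord p) * wedge11 dz (scaled H rot1 p) u v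
     + cos (zcoord p) * wedge11 (surface_connection H p) (scaled H rot2 p) u v"
    unfolding 3
    by (subst extd1_diff[OF p]; (intro smooth_forms smooth_M numeral_neq_zero)?)
      (simp add: zscale_rules smooth_forms d_scaled extd1_connection_H p)
  show "extd1 (coframe h H F4) p u v = - wedge11 (surface_connection H p) (scaled H rot1 p) u v"
    unfolding 4
    by (subst extd1_diff[OF p]; (intro smooth_forms)?) (simp add: d_scaled extd1_const)
qed

lemma connection_entries:
  "connection h H F1 F2 = upper_connection h H F1 F2"
  "connection h H F1 F3 = upper_connection h H F1 F3"
  "connection h H F1 F4 = upper_connection h H F1 F4"
  "connection h H F2 F3 = upper_connection h H F2 F3"
  "connection h H F2 F4 = upper_connection h H F2 F4"
  "connection h H F3 F4 = upper_connection h H F3 F4"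
  "connection h H F2 F1 q v = - upper_connection h H F1 F2 q v"
  "connection h H F3 F1 q v = - upper_connection h H F1 F3 q v"
  "connection h H F4 F1 q v = - upper_connection h H F1 F4 q v"
  "connection h H F3 F2 q v = - upper_connection h H F2 F3 q v"
  "connection h H F4 F2 q v = - upper_connection h H F2 F4 q v"
  "connection h H F4 F3 q v = - upper_connection h H F3 F4 q v"
  "connection h H i i q v = 0"
  by (cases i; simp add: connection_def)+

text \<open>Once half-angle formulas remove the angle \<open>z\<close>, each equation is a polynomial identity in the
  values of \<open>dz\<close>, of the two surface connections and of the rotated coordinate forms, modulo
  \<open>s\<^sup>2 + c\<^sup>2 = 1\<close>.\<close>

lemma coframe_structure_eq:
  "extd1 (coframe h H i) p u v =
    - (\<Sum>j\<in>UNIV. wedge11 (connection h H i j p) (coframe h H j p) u v)"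
proof -
  note simps = wedge11_def connection_entries upper_connection.simps coframe.simps scaled_def
    theta3_eq theta4_eq half_angle(1,2)
  note trig = half_angle(3)
  show ?thesis
  proof (cases i)
    case F1
    show ?thesis unfolding F1 sum_index extd1_coframe unfolding simps using trig by algebra
  next
    case F2
    show ?thesis unfolding F2 sum_index extd1_coframe unfolding simps
      by (simp add: field_simps power2_eq_square)
  next
    case F3
    show ?thesis unfolding F3 sum_index extd1_coframe unfolding simps
      by (simp add: field_simps power2_eq_square)
  next
    case F4
    show ?thesis unfolding F4 sum_index extd1_coframe unfolding simps using trig by algebra
  qed
qed

lemma extd1_upper_connection:
  "extd1 (upper_connection h H F1 F2) p u v =
     (s\<^sup>2 * ((H (fst p))\<^sup>2 - (h (fst p))\<^sup>2 / 2) - laplacian (\<lambda>r. ln (h r)) (fst p))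
       * wedge11 (rot1 p) (rot2 p) u v
     + s * c * wedge11 dz (surface_connection H p) u v
     - cos (zcoord p) / 2 * wedge11 dz (scaled H rot1 p) u v
     + sin (zcoord p) / 2 * wedge11 (surface_connection H p) (scaled H rot2 p) u v"
  "extd1 (upper_connection h H F1 F3) p u v =
     c / 4 * wedge11 dz (scaled h rot2 p) u v
     + s / 2 * wedge11 (surface_connection h p) (scaled h rot1 p) u v"
  "extd1 (upper_connection h H F1 F4) p u v =
     - (c / 4) * wedge11 dz (scaled h rot1 p) u v
     + s / 2 * wedge11 (surface_connection h p) (scaled h rot2 p) u v"
  "extd1 (upper_connection h H F3 F4) p u v =
     cos (zcoord p) * wedge11 dz (scaled H rot1 p) u v
     - sin (zcoord p) * wedge11 (surface_connection H p) (scaled H rot2 p) u v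
     - sin (zcoord p) * wedge11 dz (surface_connection H p) u v
     + cos (zcoord p) * ((H (fst p))\<^sup>2 - (h (fst p))\<^sup>2 / 2) * wedge11 (rot1 p) (rot2 p) u v"
  "extd1 (upper_connection h H F2 F3) p u v = extd1 (upper_connection h H F1 F4) p u v"
  "extd1 (upper_connection h H F2 F4) p u v = - extd1 (upper_connection h H F1 F3) p u v"
proof -
  show "extd1 (upper_connection h H F1 F2) p u v =
     (s\<^sup>2 * ((H (fst p))\<^sup>2 - (h (fst p))\<^sup>2 / 2) - laplacian (\<lambda>r. ln (h r)) (fst p))
       * wedge11 (rot1 p) (rot2 p) u v
     + s * c * wedge11 dz (surface_connection H p) u v
     - cos (zcoord p) / 2 * wedge11 dz (scaled H rot1 p) u v
     + sin (zcoord p) / 2 * wedge11 (surface_connection H p) (scaled H rot2 p) u v"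
    unfolding upper_connection.simps
    apply (subst extd1_diff[OF p]; (intro smooth_forms smooth_M numeral_neq_zero)?)
    apply (subst extd1_add[OF p]; (intro smooth_forms smooth_M numeral_neq_zero)?)
    unfolding zscale_rules[OF smooth_surface_connection(2)] zscale_rules[OF smooth_scaled_rot(3)]
      extd1_connection_h[OF p] extd1_connection_H[OF p] d_scaled
    by (simp add: field_simps)
  show "extd1 (upper_connection h H F3 F4) p u v =
     cos (zcoord p) * wedge11 dz (scaled H rot1 p) u v
     - sin (zcoord p) * wedge11 (surface_connection H p) (scaled H rot2 p) u v
     - sin (zcoord p) * wedge11 dz (surface_connection H p) u v
     + cos (zcoord p) * ((H (fst p))\<^sup>2 - (h (fst p))\<^sup>2 / 2) * wedge11 (rot1 p) (rot2 p) u v"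
    unfolding upper_connection.simps
    apply (subst extd1_add[OF p]; (intro smooth_forms smooth_M numeral_neq_zero)?)
    unfolding zscale_rules[OF smooth_surface_connection(2)] zscale_rules[OF smooth_scaled_rot(3)]
      extd1_connection_H[OF p] d_scaled
    by (simp add: field_simps)
  show "extd1 (upper_connection h H F1 F3) p u v =
     c / 4 * wedge11 dz (scaled h rot2 p) u v
     + s / 2 * wedge11 (surface_connection h p) (scaled h rot1 p) u v"
    unfolding upper_connection.simps zscale_rules[OF smooth_scaled_rot(2)] d_scaled by (simp add: field_simps)
  show "extd1 (upper_connection h H F1 F4) p u v =
     - (c / 4) * wedge11 dz (scaled h rot1 p) u v
     + s / 2 * wedge11 (surface_connection h p) (scaled h rot2 p) u v"
    unfolding upper_connection.simps zscale_rules[OF smooth_scaled_rot(1)] d_scaled by (simp add: field_simps)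
  show "extd1 (upper_connection h H F2 F3) p u v = extd1 (upper_connection h H F1 F4) p u v"
    by simp
  show "extd1 (upper_connection h H F2 F4) p u v = - extd1 (upper_connection h H F1 F3) p u v"
    unfolding upper_connection.simps zscale_rules[OF smooth_scaled_rot(2)] d_scaled by (simp add: field_simps)
qed

lemma coframe_frame:
  "coframe h H i p (frame h H j p) = (if i = j then 1 else 0)"
proof -
  have nz: "c * h (fst p) \<noteq> 0" "sin (zcoord p) \<noteq> 0" "c \<noteq> 0" "h (fst p) \<noteq> 0" using in_M[OF p] by auto
  define k where "k = 1 / (c * h (fst p))"
  have k: "c * h (fst p) * k = 1" using nz by (simp add: k_def)
  have t: "(sin (tcoord p))\<^sup>2 + (cos (tcoord p))\<^sup>2 = 1" by simp
  have R1: "rot1 p (frame h H F1 p) = k" "rot2 p (frame h H F1 p) = 0"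
    "surface_connection H p (frame h H F1 p) = k * (cos (zcoord p) / sin (zcoord p) * H (fst p))"
    "dz (frame h H F1 p) = 0"
  proof -
    have "rot1 p (frame h H F1 p) = cos (tcoord p) * (k * cos (tcoord p)) - sin (tcoord p) * (k * (- sin (tcoord p)))"
      unfolding rot1_def frame.simps k_def[symmetric] by simp
    also have "\<dots> = k" using t by algebra
    finally show "rot1 p (frame h H F1 p) = k" .
    show "rot2 p (frame h H F1 p) = 0" "dz (frame h H F1 p) = 0"
      "surface_connection H p (frame h H F1 p) = k * (cos (zcoord p) / sin (zcoord p) * H (fst p))"
      unfolding rot2_def surface_connection_def frame.simps k_def[symmetric]
      by (simp_all add: algebra_simps)
  qed
  have R2: "rot1 p (frame h H F2 p) = 0" "rot2 p (frame h H F2 p) = k"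
    "surface_connection H p (frame h H F2 p) = 0" "dz (frame h H F2 p) = k * H (fst p)"
  proof -
    have "rot2 p (frame h H F2 p) = sin (tcoord p) * (k * sin (tcoord p)) + cos (tcoord p) * (k * cos (tcoord p))"
      unfolding rot2_def frame.simps k_def[symmetric] by simp
    also have "\<dots> = k" using t by algebra
    finally show "rot2 p (frame h H F2 p) = k" .
    show "rot1 p (frame h H F2 p) = 0" "surface_connection H p (frame h H F2 p) = 0"
      "dz (frame h H F2 p) = k * H (fst p)"
      unfolding rot1_def surface_connection_def frame.simps k_def[symmetric]
      by (simp_all add: algebra_simps)
  qed
  have R3: "rot1 p (frame h H F3 p) = 0" "rot2 p (frame h H F3 p) = 0"
    "surface_connection H p (frame h H F3 p) = 1 / sin (zcoord p)" "dz (frame h H F3 p) = 0"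
    unfolding rot1_def rot2_def surface_connection_def frame.simps by simp_all
  have R4: "rot1 p (frame h H F4 p) = 0" "rot2 p (frame h H F4 p) = 0"
    "surface_connection H p (frame h H F4 p) = 0" "dz (frame h H F4 p) = 1"
    unfolding rot1_def rot2_def surface_connection_def frame.simps by simp_all
  show ?thesis
    using nz k
    by (cases i; cases j; simp only: coframe.simps scaled_def theta3_eq theta4_eq R1 R2 R3 R4)
      (simp_all add: mult_ac)
qed

lemma frame_expand: "(\<Sum>i\<in>UNIV. coframe h H i p v *\<^sub>R frame h H i p) = v"
proof -
  have nz: "c * h (fst p) \<noteq> 0" "sin (zcoord p) \<noteq> 0" using in_M[OF p] by auto
  have x: "coframe h H F1 p v * (1 / (c * h (fst p))) = rot1 p v"
    "coframe h H F2 p v * (1 / (c * h (fst p))) = rot2 p v"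
    using nz by (simp_all add: scaled_def)
  have 3: "coframe h H F3 p v * (1 / sin (zcoord p)) =
      surface_connection H p v - cos (zcoord p) / sin (zcoord p) * H (fst p) * rot1 p v"
    using nz by (simp add: theta3_eq scaled_def field_simps)
  have t: "(sin (tcoord p))\<^sup>2 + (cos (tcoord p))\<^sup>2 = 1" by simp
  have r: "rot1 p v * cos (tcoord p) + rot2 p v * sin (tcoord p) = dx v"
    "rot2 p v * cos (tcoord p) - rot1 p v * sin (tcoord p) = dy v"
    unfolding rot1_def rot2_def using t by algebra+
  have "(\<Sum>i\<in>UNIV. coframe h H i p v *\<^sub>R frame h H i p) =
     rot1 p v *\<^sub>R ((cos (tcoord p), - sin (tcoord p)),
      (0, cos (zcoord p) / sin (zcoord p) * H (fst p)
          + l2 H (fst p) * cos (tcoord p) - n2 H (fst p) * sin (tcoord p)))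
     + rot2 p v *\<^sub>R ((sin (tcoord p), cos (tcoord p)),
      (H (fst p), l2 H (fst p) * sin (tcoord p) + n2 H (fst p) * cos (tcoord p)))
     + ((0, 0), (0, coframe h H F3 p v * (1 / sin (zcoord p))))
     + ((0, 0), (coframe h H F4 p v, 0))"
    unfolding x[symmetric] by (simp add: UNIV_index)
  also have "\<dots> = ((dx v, dy v), (dz v, dt v))"
  proof -
    have "rot1 p v * (l2 H (fst p) * cos (tcoord p) - n2 H (fst p) * sin (tcoord p))
        + rot2 p v * (l2 H (fst p) * sin (tcoord p) + n2 H (fst p) * cos (tcoord p))
        + surface_connection H p v = dt v"
      unfolding surface_connection_def r[symmetric] by (simp add: algebra_simps)
    then show ?thesis
      unfolding 3 using r by (simp add: theta4_eq scaled_def algebra_simps zero_prod_def[symmetric])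
  qed
  finally show ?thesis by simp
qed

lemma metric4_eq: "metric4 h H p v w = (\<Sum>i\<in>UNIV. coframe h H i p v * coframe h H i p w)"
proof -
  have t: "(sin (tcoord p))\<^sup>2 + (cos (tcoord p))\<^sup>2 = 1" by simp
  have "c\<^sup>2 * surface_metric h (fst p) (fst v) (fst w) =
      coframe h H F1 p v * coframe h H F1 p w + coframe h H F2 p v * coframe h H F2 p w"
    unfolding surface_metric_def coframe.simps scaled_def rot1_def rot2_def using t by algebra
  then show ?thesis by (simp add: metric4_def UNIV_index)
qed

end

sublocale mf: moving_frame M "metric4 h H" UNIV "coframe h H" "frame h H" "connection h H"
proof
  show "finite (UNIV :: index set)" by (simp add: UNIV_index)
  show "connection h H i j p v = - connection h H j i p v" for i j p v
    by (simp add: connection_def)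
qed (use open_M smooth_coframe smooth_frame smooth_connection metric4_eq coframe_frame frame_expand
  coframe_structure_eq in blast)+

section \<open>Curvature\<close>

text \<open>The sectional curvature of the plane spanned by the first two frame vectors, the only
  component of the curvature in this frame that need not be constant.\<close>

definition horizontal_curvature :: "space4 \<Rightarrow> real" where
  "horizontal_curvature p = ((H (fst p))\<^sup>2 / 2 - (sin (zcoord p / 2))\<^sup>2 * (h (fst p))\<^sup>2
     - laplacian (\<lambda>r. ln (h r)) (fst p)) / (cos (zcoord p / 2) * h (fst p))\<^sup>2"

context
  fixes p assumes p: "p \<in> M"
begin

abbreviation (input) "W i j u v \<equiv> wedge11 (coframe h H i p) (coframe h H j p) u v"

text \<open>Cartan's second structure equation. The terms with \<open>dz\<close>, \<open>a\<close> and \<open>\<beta>\<close> combine to multiples of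
  \<open>\<theta>\<^sub>3\<close> and \<open>\<theta>\<^sub>4\<close>, whose trigonometric coefficients collapse to constants.\<close>

lemma curvature_form_upper:
  "mf.curvature_form F1 F2 p u v = horizontal_curvature p * W F1 F2 u v - W F3 F4 u v / 2"
  "mf.curvature_form F1 F3 p u v = (W F1 F3 u v - W F2 F4 u v) / 4"
  "mf.curvature_form F1 F4 p u v = (W F1 F4 u v + W F2 F3 u v) / 4"
  "mf.curvature_form F2 F3 p u v = (W F1 F4 u v + W F2 F3 u v) / 4"
  "mf.curvature_form F2 F4 p u v = (W F2 F4 u v - W F1 F3 u v) / 4"
  "mf.curvature_form F3 F4 p u v = W F3 F4 u v - W F1 F2 u v / 2"
proof -
  have pos: "cos (zcoord p / 2) * h (fst p) \<noteq> 0" using in_M[OF p] by simp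
  have "horizontal_curvature p * W F1 F2 u v =
      horizontal_curvature p * (cos (zcoord p / 2) * h (fst p))\<^sup>2 * wedge11 (rot1 p) (rot2 p) u v"
    by (simp add: wedge11_def scaled_def power2_eq_square algebra_simps)
  also have "\<dots> = ((H (fst p))\<^sup>2 / 2 - (sin (zcoord p / 2))\<^sup>2 * (h (fst p))\<^sup>2
     - laplacian (\<lambda>r. ln (h r)) (fst p)) * wedge11 (rot1 p) (rot2 p) u v"
    using pos by (simp add: horizontal_curvature_def)
  finally have K: "horizontal_curvature p * W F1 F2 u v = \<dots>" .
  note simps = wedge11_def upper_connection.simps coframe.simps scaled_def
    theta3_eq theta4_eq half_angle(1,2)[OF p] connection_entries[OF p]
  note form = mf.curvature_form_def sum_index connection_entries[OF p] extd1_upper_connection[OF p]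
  note trig = half_angle(3)[OF p]
  have cos_sq: "(cos (zcoord p / 2))\<^sup>2 = 1 - (sin (zcoord p / 2))\<^sup>2"
    by (rule cos_squared_eq)
  show "mf.curvature_form F1 F2 p u v = horizontal_curvature p * W F1 F2 u v - W F3 F4 u v / 2"
    unfolding K form unfolding simps cos_sq by (simp add: field_simps power2_eq_square)
  show "mf.curvature_form F1 F3 p u v = (W F1 F3 u v - W F2 F4 u v) / 4"
    unfolding form unfolding simps by (simp add: field_simps power2_eq_square)
  \<comment> \<open>In the next two entries the two sides agree up to a multiple of \<open>s\<^sup>2 + c\<^sup>2 - 1\<close>; keeping it as an
    explicit summand leaves a polynomial identity.\<close>
  have "mf.curvature_form F1 F4 p u v = (W F1 F4 u v + W F2 F3 u v) / 4
      - cos (zcoord p / 2) / 4 * ((sin (zcoord p / 2))\<^sup>2 + (cos (zcoord p / 2))\<^sup>2 - 1)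
        * wedge11 (scaled H rot1 p) (scaled h rot2 p) u v"
    unfolding form unfolding simps
    by (simp add: field_simps power2_eq_square del: sin_cos_squared_add sin_cos_squared_add2 sin_cos_squared_add3)
  then show "mf.curvature_form F1 F4 p u v = (W F1 F4 u v + W F2 F3 u v) / 4"
    unfolding trig by simp
  have "mf.curvature_form F2 F3 p u v = (W F1 F4 u v + W F2 F3 u v) / 4
      - cos (zcoord p / 2) / 4 * ((sin (zcoord p / 2))\<^sup>2 + (cos (zcoord p / 2))\<^sup>2 - 1)
        * wedge11 (scaled H rot1 p) (scaled h rot2 p) u v"
    unfolding form unfolding simps
    by (simp add: field_simps power2_eq_square del: sin_cos_squared_add sin_cos_squared_add2 sin_cos_squared_add3)
  then show "mf.curvature_form F2 F3 p u v = (W F1 F4 u v + W F2 F3 u v) / 4"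
    unfolding trig by simp
  show "mf.curvature_form F2 F4 p u v = (W F2 F4 u v - W F1 F3 u v) / 4"
    unfolding form unfolding simps by (simp add: field_simps power2_eq_square)
  show "mf.curvature_form F3 F4 p u v = W F3 F4 u v - W F1 F2 u v / 2"
    unfolding form unfolding simps by (simp add: field_simps power2_eq_square)
qed

lemma ricci_coframe:
  "ricci (metric4 h H) p v w =
    (horizontal_curvature p + 1 / 2) * (coframe h H F1 p v * coframe h H F1 p w + coframe h H F2 p v * coframe h H F2 p w)
    + 3 / 2 * (coframe h H F3 p v * coframe h H F3 p w + coframe h H F4 p v * coframe h H F4 p w)"
proof -
  have skew: "mf.curvature_form j i p u v = - mf.curvature_form i j p u v" for i j u v
    by (rule mf.curvature_form_skew[OF p]) auto
  have diag: "mf.curvature_form i i p u v = 0" for i u v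
    using skew[of i i u v] by simp
  note low = skew[of F2 F1] skew[of F3 F1] skew[of F4 F1] skew[of F3 F2] skew[of F4 F2] skew[of F4 F3]
  show ?thesis
    unfolding mf.ricci_eq[OF p] sum_index low diag curvature_form_upper wedge11_def
    by (simp add: coframe_frame[OF p] del: coframe.simps frame.simps) (simp add: algebra_simps)
qed

end

text \<open>The common factor of the four mixed connection forms, half of the function \<open>\<alpha>\<close> in the Lee form.\<close>

definition \<tau> :: "space4 \<Rightarrow> real" where "\<tau> p = tan (zcoord p / 2) / 2"

lemma upper_connection_coframe:
  assumes p: "p \<in> M"
  obtains m \<gamma> where
    "\<And>v. upper_connection h H F1 F3 p v = \<tau> p * coframe h H F2 p v"
    "\<And>v. upper_connection h H F1 F4 p v = - \<tau> p * coframe h H F1 p v"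
    "\<And>v. upper_connection h H F2 F3 p v = - \<tau> p * coframe h H F1 p v"
    "\<And>v. upper_connection h H F2 F4 p v = - \<tau> p * coframe h H F2 p v"
    "\<And>v. upper_connection h H F3 F4 p v = m * coframe h H F1 p v + \<gamma> * coframe h H F3 p v"
proof
  have pos: "cos (zcoord p / 2) \<noteq> 0" "sin (zcoord p) \<noteq> 0" "h (fst p) \<noteq> 0" using in_M[OF p] by auto
  show "upper_connection h H F1 F3 p v = \<tau> p * coframe h H F2 p v"
    "upper_connection h H F1 F4 p v = - \<tau> p * coframe h H F1 p v"
    "upper_connection h H F2 F3 p v = - \<tau> p * coframe h H F1 p v"
    "upper_connection h H F2 F4 p v = - \<tau> p * coframe h H F2 p v" for v
    using pos by (simp_all add: \<tau>_def tan_def)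
  fix v
  define r where "r = 1 / sin (zcoord p)"
  have r: "r * sin (zcoord p) = 1" using pos by (simp add: r_def)
  have m: "H (fst p) * r / (cos (zcoord p / 2) * h (fst p)) * coframe h H F1 p v = scaled H rot1 p v * r"
    using pos by (simp add: scaled_def)
  have t: "(sin (zcoord p))\<^sup>2 + (cos (zcoord p))\<^sup>2 = 1"
    by simp
  show "upper_connection h H F3 F4 p v =
      H (fst p) * (1 / sin (zcoord p)) / (cos (zcoord p / 2) * h (fst p)) * coframe h H F1 p v
      + cos (zcoord p) * (1 / sin (zcoord p)) * coframe h H F3 p v"
    unfolding r_def[symmetric] m unfolding upper_connection.simps coframe.simps theta3_eq
    using r t by algebra
qed

text \<open>All connection forms except \<open>C = \<omega>\<^sub>1\<^sub>2\<close> are combinations of the coframe, so the structure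
  equations close up to \<open>C\<close>. Existence of \<open>C\<close>, \<open>m\<close> and \<open>\<gamma>\<close> suffices for the complex structures: the
  only coefficient that enters the differentials of the Kaehler forms is \<open>\<tau>\<close>.\<close>

lemma extd1_coframe_in_coframe:
  assumes p: "p \<in> M"
  obtains C m \<gamma> where
    "\<And>u v. extd1 (coframe h H F1) p u v = - wedge11 C (coframe h H F2 p) u v
       - \<tau> p * W p F2 F3 u v + \<tau> p * W p F1 F4 u v"
    "\<And>u v. extd1 (coframe h H F2) p u v = wedge11 C (coframe h H F1 p) u v
       + \<tau> p * W p F1 F3 u v + \<tau> p * W p F2 F4 u v"
    "\<And>u v. extd1 (coframe h H F3) p u v =
       - 2 * \<tau> p * W p F1 F2 u v - m * W p F1 F4 u v - \<gamma> * W p F3 F4 u v"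
    "\<And>u v. extd1 (coframe h H F4) p u v = m * W p F1 F3 u v"
proof -
  obtain m \<gamma> where U:
    "\<And>v. upper_connection h H F1 F3 p v = \<tau> p * coframe h H F2 p v"
    "\<And>v. upper_connection h H F1 F4 p v = - \<tau> p * coframe h H F1 p v"
    "\<And>v. upper_connection h H F2 F3 p v = - \<tau> p * coframe h H F1 p v"
    "\<And>v. upper_connection h H F2 F4 p v = - \<tau> p * coframe h H F2 p v"
    "\<And>v. upper_connection h H F3 F4 p v = m * coframe h H F1 p v + \<gamma> * coframe h H F3 p v"
    by (rule upper_connection_coframe[OF p]) blast
  note S = coframe_structure_eq[OF p] sum_index wedge11_def connection_entries[OF p] U
  show ?thesis
    by (rule that[of "upper_connection h H F1 F2 p" m \<gamma>]; unfold S)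
      (simp_all add: algebra_simps del: coframe.simps upper_connection.simps)
qed

section \<open>The two complex structures\<close>

text \<open>The sign \<open>\<epsilon>\<close> selects the orientation of the plane of \<open>e\<^sub>3\<close> and \<open>e\<^sub>4\<close>, so that both structures of
  the theorem are treated at once: \<open>\<epsilon> = 1\<close> is the Hermitian one, \<open>\<epsilon> = - 1\<close> the Kaehler one.\<close>

definition J :: "real \<Rightarrow> space4 endo" where
  "J \<epsilon> p v = coframe h H F1 p v *\<^sub>R frame h H F2 p - coframe h H F2 p v *\<^sub>R frame h H F1 p
     + \<epsilon> *\<^sub>R (coframe h H F3 p v *\<^sub>R frame h H F4 p - coframe h H F4 p v *\<^sub>R frame h H F3 p)"

lemma coframe_J:
  assumes p: "p \<in> M"
  shows "coframe h H F1 p (J \<epsilon> p v) = - coframe h H F2 p v"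
    "coframe h H F2 p (J \<epsilon> p v) = coframe h H F1 p v"
    "coframe h H F3 p (J \<epsilon> p v) = - \<epsilon> * coframe h H F4 p v"
    "coframe h H F4 p (J \<epsilon> p v) = \<epsilon> * coframe h H F3 p v"
  unfolding J_def
  by (simp_all add: linear_add linear_diff linear_cmul mf.linear_E[OF p] coframe_frame[OF p]
      del: coframe.simps frame.simps)

lemma smooth_form1_on: "smooth_form1 M \<alpha> \<Longrightarrow> smooth_on M (\<lambda>p. \<alpha> p v)"
  unfolding smooth_form1_def by blast

lemma metric4_sum:
  "p \<in> M \<Longrightarrow> metric4 h H p v w = coframe h H F1 p v * coframe h H F1 p w
    + coframe h H F2 p v * coframe h H F2 p w + coframe h H F3 p v * coframe h H F3 p w
    + coframe h H F4 p v * coframe h H F4 p w"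
  by (simp only: metric4_eq sum_index)

lemma riemannian_metric4: "riemannian_metric M (metric4 h H)"
  unfolding riemannian_metric_def
proof (intro conjI ballI allI impI)
  fix p assume p: "p \<in> M"
  have L: "linear (coframe h H i p)" for i using mf.linear_E[OF p] by simp
  show "bilinear (metric4 h H p)"
    unfolding bilinear_def metric4_sum[OF p]
    by (intro conjI allI linearI;
        simp add: linear_add[OF L] linear_cmul[OF L] algebra_simps del: coframe.simps)
  show "metric4 h H p v w = metric4 h H p w v" for v w
    unfolding metric4_sum[OF p] by (simp add: mult.commute)
  fix v :: space4 assume "v \<noteq> 0"
  have "\<exists>i. coframe h H i p v \<noteq> 0"
    using mf.eq_if_E_eq[OF p, of v 0] \<open>v \<noteq> 0\<close> linear_0[OF L] by auto
  then obtain i where "coframe h H i p v \<noteq> 0" ..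
  then have "(\<Sum>i\<in>UNIV. coframe h H i p v * coframe h H i p v) > 0"
    by (intro sum_pos2[of _ i]) (auto simp: mf.finite_I zero_less_mult_iff linorder_neq_iff simp del: coframe.simps)
  then show "metric4 h H p v v > 0" by (simp only: metric4_eq[OF p])
next
  fix v w
  show "smooth_on M (\<lambda>p. metric4 h H p v w)"
    by (subst smooth_on_cong[OF open_M metric4_sum], assumption)
      (intro smooth_M smooth_form1_on[OF smooth_coframe])
qed

context
  fixes \<epsilon> :: real
  assumes \<epsilon>: "\<epsilon> = 1 \<or> \<epsilon> = - 1"
begin

lemma almost_complex_J: "almost_complex_structure M (J \<epsilon>)"
  unfolding almost_complex_structure_def
proof (intro conjI ballI allI)
  fix p assume p: "p \<in> M"
  have L: "linear (coframe h H i p)" for i using mf.linear_E[OF p] by simp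
  show "linear (J \<epsilon> p)"
    unfolding J_def
    by (rule linearI) (simp_all add: linear_add[OF L] linear_cmul[OF L] algebra_simps del: coframe.simps frame.simps)
  show "J \<epsilon> p (J \<epsilon> p v) = - v" for v
  proof (rule mf.eq_if_E_eq[OF p])
    show "coframe h H i p (J \<epsilon> p (J \<epsilon> p v)) = coframe h H i p (- v)" for i
      using \<epsilon> by (cases i; simp only: coframe_J[OF p] linear_neg[OF L]) auto
  qed
next
  show "smooth_on M (\<lambda>p. J \<epsilon> p v)" for v
    unfolding J_def by (intro smooth_M smooth_form1_on smooth_coframe smooth_frame)
qed

lemma almost_hermitian_J: "almost_hermitian M (metric4 h H) (J \<epsilon>)"
proof -
  have "metric4 h H p (J \<epsilon> p v) (J \<epsilon> p w) = metric4 h H p v w" if p: "p \<in> M" for p v w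
    unfolding metric4_sum[OF p] coframe_J[OF p] using \<epsilon> by auto
  then show ?thesis
    by (simp add: almost_hermitian_def riemannian_metric4 almost_complex_J)
qed

lemma kaehler_form_J:
  assumes p: "p \<in> M"
  shows "kaehler_form (metric4 h H) (J \<epsilon>) p v w = W p F1 F2 v w + \<epsilon> * W p F3 F4 v w"
  unfolding kaehler_form_def metric4_sum[OF p] coframe_J[OF p] wedge11_def
  by (simp add: algebra_simps del: coframe.simps)

lemma smooth_form1_cmult: "smooth_form1 M (\<lambda>q v. r * coframe h H i q v)"
  by (intro smooth_form1_scale smooth_on_const open_M smooth_coframe)

lemma extd1_cmult:
  assumes "p \<in> M"
  shows "extd1 (\<lambda>q v. r * coframe h H i q v) p u v = r * extd1 (coframe h H i) p u v"
proof -
  have "dderiv (\<lambda>q. r) p w = 0" for w :: space4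
    by (rule dderiv_eq) simp
  then show ?thesis
    by (subst extd1_scale) (simp_all add: mf.diff_E[OF assms] wedge11_def)
qed

text \<open>The transpose of \<open>J\<close> permutes the coframe up to sign, so the covector form of the Nijenhuis
  tensor only involves the exterior derivatives of the coframe. Inserting the structure equations
  gives zero, in accordance with the absence of a (0,2)-part in \<open>d(E\<^sub>1 + i E\<^sub>2)\<close> and
  \<open>d(E\<^sub>3 + i \<epsilon> E\<^sub>4)\<close>.\<close>

lemma integrable_J: "integrable_structure M (J \<epsilon>)"
  unfolding integrable_structure_def
proof (intro allI impI ballI)
  fix X Y :: "space4 vfield" and p
  assume X: "smooth_on M X" and Y: "smooth_on M Y" and p: "p \<in> M"
  have L: "linear (coframe h H i p)" for i using mf.linear_E[OF p] by simp
  obtain C m \<gamma> where D: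
    "\<And>u v. extd1 (coframe h H F1) p u v = - wedge11 C (coframe h H F2 p) u v
       - \<tau> p * W p F2 F3 u v + \<tau> p * W p F1 F4 u v"
    "\<And>u v. extd1 (coframe h H F2) p u v = wedge11 C (coframe h H F1 p) u v
       + \<tau> p * W p F1 F3 u v + \<tau> p * W p F2 F4 u v"
    "\<And>u v. extd1 (coframe h H F3) p u v =
       - 2 * \<tau> p * W p F1 F2 u v - m * W p F1 F4 u v - \<gamma> * W p F3 F4 u v"
    "\<And>u v. extd1 (coframe h H F4) p u v = m * W p F1 F3 u v"
    by (rule extd1_coframe_in_coframe[OF p]) blast
  have N: "coframe h H i p (nijenhuis (J \<epsilon>) X Y p) =
      extd1 (coframe h H i) p (X p) (Y p) - extd1 (coframe h H i) p (J \<epsilon> p (X p)) (J \<epsilon> p (Y p))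
      + r * extd1 (coframe h H j) p (J \<epsilon> p (X p)) (Y p)
      + r * extd1 (coframe h H j) p (X p) (J \<epsilon> p (Y p))"
    if "\<And>q v. q \<in> M \<Longrightarrow> coframe h H i q (J \<epsilon> q v) = r * coframe h H j q v" for i j r
    using nijenhuis_covector[OF open_M p almost_complex_J smooth_coframe smooth_form1_cmult that X Y]
    unfolding extd1_cmult[OF p] .
  have J1: "coframe h H F1 q (J \<epsilon> q v) = (- 1) * coframe h H F2 q v" if "q \<in> M" for q v
    using coframe_J(1)[OF that] by simp
  have J2: "coframe h H F2 q (J \<epsilon> q v) = 1 * coframe h H F1 q v" if "q \<in> M" for q v
    using coframe_J(2)[OF that] by simp
  note N = N[OF J1] N[OF J2] N[OF coframe_J(3)] N[OF coframe_J(4)]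
  have "coframe h H i p (nijenhuis (J \<epsilon>) X Y p) = 0" for i
    using \<epsilon>
    by (cases i; simp only: N; unfold D wedge11_def coframe_J[OF p])
      (elim disjE; simp add: algebra_simps del: coframe.simps)+
  then show "nijenhuis (J \<epsilon>) X Y p = 0"
    by (intro mf.eq_if_E_eq[OF p]) (simp add: linear_0[OF L] del: coframe.simps)
qed

text \<open>Only two terms survive: \<open>d(E\<^sub>1 \<and> E\<^sub>2)\<close> contributes \<open>- 2 \<tau>\<close> through the \<open>E\<^sub>4\<close>-parts of
  \<open>dE\<^sub>1\<close> and \<open>dE\<^sub>2\<close>, and \<open>\<epsilon> d(E\<^sub>3 \<and> E\<^sub>4)\<close> contributes \<open>- 2 \<epsilon> \<tau>\<close> through the term
  \<open>- 2 \<tau> E\<^sub>1 \<and> E\<^sub>2\<close> of \<open>dE\<^sub>3\<close>.\<close>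

lemma extd2_kaehler_form_J:
  assumes p: "p \<in> M"
  shows "extd2 (kaehler_form (metric4 h H) (J \<epsilon>)) p u v w =
    - 2 * (1 + \<epsilon>) * \<tau> p * wedge12 (coframe h H F4 p) (\<lambda>v w. W p F1 F2 v w) u v w"
proof -
  obtain C m \<gamma> where D:
    "\<And>u v. extd1 (coframe h H F1) p u v = - wedge11 C (coframe h H F2 p) u v
       - \<tau> p * W p F2 F3 u v + \<tau> p * W p F1 F4 u v"
    "\<And>u v. extd1 (coframe h H F2) p u v = wedge11 C (coframe h H F1 p) u v
       + \<tau> p * W p F1 F3 u v + \<tau> p * W p F2 F4 u v"
    "\<And>u v. extd1 (coframe h H F3) p u v =
       - 2 * \<tau> p * W p F1 F2 u v - m * W p F1 F4 u v - \<gamma> * W p F3 F4 u v"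
    "\<And>u v. extd1 (coframe h H F4) p u v = m * W p F1 F3 u v"
    by (rule extd1_coframe_in_coframe[OF p]) blast
  note d = mf.diff_E[OF p UNIV_I] smooth_form1_differentiable[OF smooth_form1_cmult p]
  have d2: "(\<lambda>q. wedge11 (\<alpha> q) (\<beta> q) v w) differentiable (at p)"
    if "\<And>v. (\<lambda>q. \<alpha> q v) differentiable (at p)" "\<And>v. (\<lambda>q. \<beta> q v) differentiable (at p)"
    for \<alpha> \<beta> :: "space4 form1" and v w
    unfolding wedge11_def by (intro differentiable_diff differentiable_mult that)
  have "extd2 (kaehler_form (metric4 h H) (J \<epsilon>)) p u v w =
      extd2 (\<lambda>q v w. wedge11 (coframe h H F1 q) (coframe h H F2 q) v w
        + wedge11 (coframe h H F3 q) (\<lambda>v. \<epsilon> * coframe h H F4 q v) v w) p u v w"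
    by (rule extd2_cong_open[OF open_M p], subst kaehler_form_J)
      (simp_all add: wedge11_def algebra_simps del: coframe.simps)
  also have "\<dots> = wedge12 (coframe h H F2 p) (extd1 (coframe h H F1) p) u v w
      - wedge12 (coframe h H F1 p) (extd1 (coframe h H F2) p) u v w
      + (wedge12 (\<lambda>v. \<epsilon> * coframe h H F4 p v) (extd1 (coframe h H F3) p) u v w
      - wedge12 (coframe h H F3 p) (extd1 (\<lambda>q v. \<epsilon> * coframe h H F4 q v) p) u v w)"
    by (subst extd2_add, (rule d2 d)+, subst (1 2) extd2_wedge11, (rule d)+) (rule refl)
  also have "\<dots> = - 2 * (1 + \<epsilon>) * \<tau> p * wedge12 (coframe h H F4 p) (\<lambda>v w. W p F1 F2 v w) u v w"
    unfolding wedge12_def extd1_cmult[OF p] D wedge11_def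
    by (simp add: algebra_simps del: coframe.simps)
  finally show ?thesis .
qed

end

section \<open>Kaehler forms, Ricci tensor and Lee form\<close>

lemma hermitian_J: "\<epsilon> = 1 \<or> \<epsilon> = - 1 \<Longrightarrow> hermitian M (metric4 h H) (J \<epsilon>)"
  by (simp add: hermitian_def almost_hermitian_J integrable_J)

lemma kaehler_J: "kaehler M (metric4 h H) (J (- 1))"
  by (simp add: kaehler_def hermitian_J extd2_kaehler_form_J)

lemma ricci_J_invariant: "ricci_J_invariant M (metric4 h H) (J 1)"
  unfolding ricci_J_invariant_def
  by (intro ballI allI, simp only: ricci_coframe coframe_J) (simp add: algebra_simps del: coframe.simps)

lemma W_F1_F2:
  "W p F1 F2 v w = (cos (zcoord p / 2))\<^sup>2 * surface_volume h (fst p) (fst v) (fst w)"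
proof -
  have "W p F1 F2 v w = (cos (zcoord p / 2))\<^sup>2 * (h (fst p))\<^sup>2 * wedge11 (rot1 p) (rot2 p) v w"
    by (simp add: wedge11_def scaled_def power2_eq_square algebra_simps)
  then show ?thesis
    unfolding wedge11_rot by (simp add: surface_volume_def wedge11_def)
qed

lemma kaehler_form_eq_Omega:
  assumes "p \<in> M"
  shows "kaehler_form (metric4 h H) (J 1) p v w = Omega h H p v w"
    and "kaehler_form (metric4 h H) (J (- 1)) p v w = Omega_bar h H p v w"
  by (simp_all add: kaehler_form_J[OF _ assms] Omega_def Omega_bar_def W_F1_F2 del: coframe.simps)
    (simp_all add: wedge11_def)

definition lee :: "space4 form1" where
  "lee p v = - tan (zcoord p / 2) * theta4 H p v"

lemma smooth_lee: "smooth_form1 M lee"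
proof -
  have "smooth_on M (\<lambda>p. - (sin (zcoord p / 2) / cos (zcoord p / 2)))"
    by (intro smooth_M numeral_neq_zero) (use in_M(7) in force)
  then show ?thesis
    unfolding lee_def[abs_def] tan_def
    by (intro smooth_form1_scale open_M smooth_theta)
qed

text \<open>Uniqueness holds because a one-form \<open>\<delta>\<close> with \<open>\<delta> \<and> \<Omega> = 0\<close> vanishes: on a triple that consists of
  one frame vector and the two vectors of the other plane, \<open>\<delta> \<and> \<Omega>\<close> takes the value of \<open>\<delta>\<close> on that
  frame vector.\<close>

lemma is_lee_form_iff:
  "is_lee_form M (metric4 h H) (J 1) \<theta> \<longleftrightarrow> (\<forall>p\<in>M. \<forall>v. \<theta> p v = lee p v)"
proof -
  have d: "extd2 (kaehler_form (metric4 h H) (J 1)) p u v w =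
      2 * wedge12 (lee p) (kaehler_form (metric4 h H) (J 1) p) u v w" if p: "p \<in> M" for p u v w
    by (simp add: extd2_kaehler_form_J[OF _ p] kaehler_form_J[OF _ p] wedge12_def lee_def \<tau>_def
        wedge11_def algebra_simps del: coframe.simps(1-3))
  show ?thesis
  proof
    assume *: "\<forall>p\<in>M. \<forall>v. \<theta> p v = lee p v"
    have eq: "\<theta> p = lee p" if "p \<in> M" for p
      using * that by (intro ext) blast
    have "linear (\<theta> p)" if "p \<in> M" for p
      using smooth_lee that by (simp add: eq smooth_form1_def)
    moreover have "smooth_on M (\<lambda>p. \<theta> p v)" for v
    proof -
      have "smooth_on M (\<lambda>p. \<theta> p v) \<longleftrightarrow> smooth_on M (\<lambda>p. lee p v)"
        by (rule smooth_on_cong[OF open_M]) (simp add: eq)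
      then show ?thesis using smooth_form1_on[OF smooth_lee] by blast
    qed
    ultimately have "smooth_form1 M \<theta>" unfolding smooth_form1_def by blast
    then show "is_lee_form M (metric4 h H) (J 1) \<theta>"
      unfolding is_lee_form_def using d eq by simp
  next
    assume *: "is_lee_form M (metric4 h H) (J 1) \<theta>"
    show "\<forall>p\<in>M. \<forall>v. \<theta> p v = lee p v"
    proof (intro ballI allI)
      fix p v assume p: "p \<in> M"
      define \<delta> where "\<delta> v = \<theta> p v - lee p v" for v
      have lin: "linear \<delta>"
        using * smooth_lee p unfolding \<delta>_def is_lee_form_def smooth_form1_def
        by (intro linear_compose_sub) auto
      have eq: "wedge12 \<delta> (kaehler_form (metric4 h H) (J 1) p) a b c = 0" for a b c
      proof -
        have "2 * wedge12 (\<theta> p) (kaehler_form (metric4 h H) (J 1) p) a b c =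
            2 * wedge12 (lee p) (kaehler_form (metric4 h H) (J 1) p) a b c"
          using * p unfolding is_lee_form_def d[OF p, symmetric] by metis
        then show ?thesis by (simp add: wedge12_def \<delta>_def algebra_simps)
      qed
      define e where "e i = frame h H i p" for i
      have K: "kaehler_form (metric4 h H) (J 1) p (e i) (e j) =
          (if i = F1 \<and> j = F2 \<or> i = F3 \<and> j = F4 then 1
           else if i = F2 \<and> j = F1 \<or> i = F4 \<and> j = F3 then - 1 else 0)" for i j
        by (cases i; cases j)
          (simp_all add: kaehler_form_J[OF _ p] wedge11_def e_def coframe_frame[OF p]
            del: coframe.simps frame.simps)
      have "\<delta> (e F1) = 0" "\<delta> (e F2) = 0" "\<delta> (e F3) = 0" "\<delta> (e F4) = 0"
        using eq[of "e F1" "e F3" "e F4"] eq[of "e F2" "e F3" "e F4"]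
          eq[of "e F3" "e F1" "e F2"] eq[of "e F4" "e F1" "e F2"]
        by (simp_all add: wedge12_def K)
      then have "\<delta> (frame h H i p) = 0" for i
        by (cases i) (simp_all add: e_def del: frame.simps)
      then have "\<delta> (\<Sum>i\<in>UNIV. coframe h H i p v *\<^sub>R frame h H i p) = 0"
        by (simp add: linear_sum[OF lin] linear_cmul[OF lin] del: coframe.simps frame.simps)
      then show "\<theta> p v = lee p v"
        unfolding frame_expand[OF p] \<delta>_def by simp
    qed
  qed
qed

lemma not_locally_conformally_kaehler:
  assumes "U \<noteq> {}"
  shows "\<not> locally_conformally_kaehler M (metric4 h H) (J 1)"
proof
  assume "locally_conformally_kaehler M (metric4 h H) (J 1)"
  then obtain \<theta> where \<theta>: "\<And>p v. p \<in> M \<Longrightarrow> \<theta> p v = lee p v"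
    and closed: "\<And>p u v. p \<in> M \<Longrightarrow> extd1 \<theta> p u v = 0"
    unfolding locally_conformally_kaehler_def is_lee_form_iff by blast
  obtain q where q: "q \<in> U" using assms by blast
  \<comment> \<open>At \<open>t = 0\<close> the coefficient of \<open>dt \<and> dx\<close> in the differential of the Lee form is
    \<open>tan (z/2) H\<close>, and \<open>z = pi / 2\<close> makes the tangent equal to 1.\<close>
  define p :: space4 where "p = (q, (pi / 2, 0))"
  have p: "p \<in> M" using q pi_gt_zero by (simp add: M_def p_def)
  have t: "((\<lambda>z. - tan (z / 2)) has_real_derivative - (1 / (cos (zcoord p / 2))\<^sup>2) / 2) (at (zcoord p))"
    using in_M(7)[OF p] by (auto intro!: derivative_eq_intros simp: field_simps)
  have "extd1 \<theta> p ((0, 0), (0, 1)) ((1, 0), (0, 0)) = extd1 lee p ((0, 0), (0, 1)) ((1, 0), (0, 0))"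
    by (rule extd1_cong_open[OF open_M p \<theta>])
  also have "\<dots> = tan (pi / 4) * H q"
    unfolding lee_def[abs_def] extd1_zscale[OF p smooth_theta(2) t]
    using extd1_coframe(4)[OF p]
    by (simp add: wedge11_def surface_connection_def scaled_def rot1_def p_def)
  also have "\<dots> > 0" using H_pos[OF q] by (simp add: tan_45)
  finally show False using closed[OF p] by simp
qed

end

theorem theorem2:
  fixes U :: "(real \<times> real) set" and h H :: "real \<times> real \<Rightarrow> real"
  assumes "open U" and "U \<noteq> {}"
    and "smooth_on U h" and "\<forall>q\<in>U. h q > 0"
    and "smooth_on U H" and "\<forall>q\<in>U. H q > 0"
    and "\<forall>q\<in>U. laplacian (\<lambda>r. ln (H r)) q = (1/2) * (h q)\<^sup>2 - (H q)\<^sup>2"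
  defines "M \<equiv> U \<times> {(z, t). 0 < z \<and> z < pi}"
    and "g \<equiv> metric4 h H"
  shows "(\<exists>Jbar. kaehler M g Jbar \<and>
            (\<forall>p\<in>M. \<forall>v w. kaehler_form g Jbar p v w = Omega_bar h H p v w)) \<and>
         (\<exists>J. hermitian M g J \<and>
            (\<forall>p\<in>M. \<forall>v w. kaehler_form g J p v w = Omega h H p v w) \<and>
            ricci_J_invariant M g J \<and>
            \<not> locally_conformally_kaehler M g J \<and>
            (\<forall>\<theta>. is_lee_form M g J \<theta> \<longleftrightarrow>
               (\<forall>p\<in>M. \<forall>v. \<theta> p v = - tan (zcoord p / 2) * theta4 H p v)))"
proof -
  interpret twisted_metric U h H
    using assms(1-7) by unfold_locales auto
  have M: "twisted_metric.M U = M"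
    unfolding M_def assms(8) ..
  show ?thesis
    unfolding g_def
    using kaehler_J hermitian_J[of 1] kaehler_form_eq_Omega ricci_J_invariant
      not_locally_conformally_kaehler[OF assms(2)] is_lee_form_iff
    unfolding M lee_def by blast
qed

end
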